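(* Let $X=\sum_{\ell,m,s}a^\ell_{m,s}\phi^\ell_{m,s}$ be a random field on $SU(2)$. (a) If $X$ is $2$-weakly bi-invariant (with $\mathbb{E}\|X\|^2>0$), then for every $\ell\in\frac12\mathbb{N}$ the weak spectral probability $\Sigma\mathbb{E}[X]$ is uniform on the set $\{\ell\}\times\{-\ell,\dots,\ell\}\times\{-\ell,\dots,\ell\}$, i.e. $\Sigma\mathbb{E}[X](\{(\ell,m,s)\})$ depends only on $\ell$. (b) If $X$ is square integrable and strongly bi-invariant (with $\|X\|>0$ almost surely), then the same is true for the strong spectral probability $\mathbb{E}\Sigma[X]$.
   Context: $\frac12\mathbb{N}=\{0,\frac12,1,\dots\}$; $m,s\in\{-\ell,-\ell+1,\dots,\ell\}$. Elements of $SU(2)$ are $h(\alpha,\beta)=\begin{pmatrix}\alpha&-\overline\beta\\ \beta&\overline\alpha\end{pmatrix}$, $|\alpha|^2+|\beta|^2=1$; $SU(2)$ carries the metric of the round 3-sphere of radius 2; $\|\cdot\|$ is the $L^2(SU(2))$ norm. Wigner functions: with $\psi^\ell_m(z_0,z_1)=\binom{2\ell}{\ell+m}^{1/2}z_0^{\ell+m}z_1^{\ell-m}$, $D^\ell_{m,s}:SU(2)\to\mathbb{C}$ is defined by $\sum_m\psi^\ell_m(z_0,z_1)D^\ell_{m,s}(h(\alpha,\beta))=\psi^\ell_s(\overline\alpha z_0+\overline\beta z_1,-\beta z_0+\alpha z_1)$ for all $z_0,z_1\in\mathbb{C}$. The functions $\phi^\ell_{m,s}=\frac{\sqrt{2\ell+1}}{4\pi}D^\ell_{m,s}$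 form an orthonormal basis of $L^2(SU(2))$. Random fields are jointly measurable $X:\Omega\times SU(2)\to\mathbb{C}$; square integrable means $X(\omega,\cdot)\in L^2(SU(2))$ almost surely. $X$ is strongly bi-invariant if $X(g^{-1}\cdot g')$ has the same law as $X$ for all $g,g'\in SU(2)$. $X$ is $2$-weakly bi-invariant if $\mathbb{E}|X(g)|^2<\infty$ for all $g$ and, for every $\phi:g\mapsto hgh'$ with $h,h'\in SU(2)$, $\mathbb{E}X(\phi(g))=\mathbb{E}X(g)$, $\mathbb{E}\{X(\phi(g_1))X(\phi(g_2))\}=\mathbb{E}\{X(g_1)X(g_2)\}$ and $\mathbb{E}\{X(\phi(g_1))\overline{X(\phi(g_2))}\}=\mathbb{E}\{X(g_1)\overline{X(g_2)}\}$ for all $g,g_1,g_2$; such fields are almost surely in $L^2(SU(2))$. Spectral probabilities are measures on $\{(\ell,m,s):\ell\in\frac12\mathbb{N},\ m,s\in\{-\ell,\dots,\ell\}\}$: the weak one is $\Sigma\mathbb{E}[X](\{(\ell,m,s)\})=\mathbb{E}|a^\ell_{m,s}|^2/\mathbb{E}\|X\|^2$, the strong one is $\mathbb{E}\Sigma[X](\{(\ell,m,s)\})=\mathbb{E}\left(|a^\ell_{m,s}|^2/\|X\|^2\right)$. *)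

theory Defs
  imports "HOL-Probability.Probability"
begin

subsection \<open>The group SU(2) and its volume measure\<close>

type_synonym cmat2 = "complex ^ 2 ^ 2"

definition su2_mat :: "complex \<Rightarrow> complex \<Rightarrow> cmat2" where
  "su2_mat \<alpha> \<beta> = vector [vector [\<alpha>, - cnj \<beta>], vector [\<beta>, cnj \<alpha>]]"

definition SU2 :: "cmat2 set" where
  "SU2 = {su2_mat \<alpha> \<beta> | \<alpha> \<beta>. (cmod \<alpha>)\<^sup>2 + (cmod \<beta>)\<^sup>2 = 1}"

text \<open>
  Volume measure of the round 3-sphere of radius 2, with \<open>su2_mat \<alpha> \<beta>\<close> identified with the point
  \<open>2 (\<alpha>, \<beta>)\<close> of the Euclidean space \<open>complex \<times> complex\<close> of real dimension 4. On the sphere of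
  radius \<open>r\<close> in dimension \<open>n\<close>, the surface measure of \<open>A\<close> is \<open>n / r\<close> times the Lebesgue measure of
  the cone \<open>{t x | x \<in> A, 0 < t < 1}\<close>; here \<open>n / r = 4 / 2\<close>, and the cone is the preimage of \<open>A\<close>
  under the radial projection of the punctured ball of radius 2.
\<close>
definition su2_measure :: "cmat2 measure" where
  "su2_measure = scale_measure 2
     (distr (restrict_space lborel (ball (0 :: complex \<times> complex) 2 - {0})) (restrict_space borel SU2)
        (\<lambda>z. su2_mat (fst z / of_real (norm z)) (snd z / of_real (norm z))))"

definition su2_norm :: "(cmat2 \<Rightarrow> complex) \<Rightarrow> real" where
  "su2_norm f = sqrt (\<integral>g. (cmod (f g))\<^sup>2 \<partial>su2_measure)"

definition su2_square_integrable :: "(cmat2 \<Rightarrow> complex) \<Rightarrow> bool" where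
  "su2_square_integrable f \<longleftrightarrow>
     f \<in> borel_measurable su2_measure \<and> integrable su2_measure (\<lambda>g. (cmod (f g))\<^sup>2)"


subsection \<open>Wigner functions\<close>

definition half_nats :: "real set" where
  "half_nats = {real n / 2 | n. True}"

definition weights :: "real \<Rightarrow> real set" where
  "weights l = {- l + real k | k. - l + real k \<le> l}"

text \<open>For \<open>l \<in> half_nats\<close> and \<open>m \<in> weights l\<close> the numbers \<open>2 l\<close>, \<open>l + m\<close> and \<open>l - m\<close> are natural,
  so that \<open>nat \<lfloor>_\<rfloor>\<close> is only a coercion.\<close>
definition wigner_psi :: "real \<Rightarrow> real \<Rightarrow> complex \<Rightarrow> complex \<Rightarrow> complex" where
  "wigner_psi l m z0 z1 =
     of_real (sqrt (real (nat \<lfloor>2 * l\<rfloor> choose nat \<lfloor>l + m\<rfloor>))) * z0 ^ nat \<lfloor>l + m\<rfloor> * z1 ^ nat \<lfloor>l - m\<rfloor>"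

text \<open>The column \<open>m \<mapsto> D\<^sup>l\<^sub>m\<^sub>,\<^sub>s(g)\<close> is determined by an identity of polynomials in \<open>z0\<close>, \<open>z1\<close>;
  it is extended by 0 outside \<open>weights l\<close>. The entries \<open>\<alpha>\<close>, \<open>\<beta>\<close> of \<open>su2_mat \<alpha> \<beta>\<close>
  are \<open>g $ 1 $ 1\<close> and \<open>g $ 2 $ 1\<close>. Lemma \<open>wigner_D_ex1\<close> shows that the description is proper.\<close>
definition is_wigner_column :: "real \<Rightarrow> real \<Rightarrow> cmat2 \<Rightarrow> (real \<Rightarrow> complex) \<Rightarrow> bool" where
  "is_wigner_column l s g d \<longleftrightarrow>
     (\<forall>m. m \<notin> weights l \<longrightarrow> d m = 0) \<and>
     (\<forall>z0 z1. (\<Sum>m\<in>weights l. wigner_psi l m z0 z1 * d m) =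
        wigner_psi l s (cnj (g $ 1 $ 1) * z0 + cnj (g $ 2 $ 1) * z1)
          (- (g $ 2 $ 1) * z0 + g $ 1 $ 1 * z1))"

definition wigner_D :: "real \<Rightarrow> real \<Rightarrow> real \<Rightarrow> cmat2 \<Rightarrow> complex" where
  "wigner_D l m s g = (THE d. is_wigner_column l s g d) m"

definition wigner_phi :: "real \<Rightarrow> real \<Rightarrow> real \<Rightarrow> cmat2 \<Rightarrow> complex" where
  "wigner_phi l m s g = of_real (sqrt (2 * l + 1) / (4 * pi)) * wigner_D l m s g"


subsection \<open>Random fields and invariance\<close>

definition random_field :: "'w measure \<Rightarrow> ('w \<Rightarrow> cmat2 \<Rightarrow> complex) \<Rightarrow> bool" where
  "random_field M X \<longleftrightarrow> case_prod X \<in> borel_measurable (M \<Otimes>\<^sub>M su2_measure)"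

definition square_integrable_field :: "'w measure \<Rightarrow> ('w \<Rightarrow> cmat2 \<Rightarrow> complex) \<Rightarrow> bool" where
  "square_integrable_field M X \<longleftrightarrow> (AE \<omega> in M. su2_square_integrable (X \<omega>))"

text \<open>The law of a field is its distribution on \<open>SU2 \<rightarrow> complex\<close> with the product sigma-algebra, that
  is, the collection of its finite-dimensional distributions.\<close>
definition field_law :: "'w measure \<Rightarrow> ('w \<Rightarrow> cmat2 \<Rightarrow> complex) \<Rightarrow> (cmat2 \<Rightarrow> complex) measure" where
  "field_law M X = distr M (Pi\<^sub>M SU2 (\<lambda>_. borel)) (\<lambda>\<omega>. restrict (X \<omega>) SU2)"

definition strongly_bi_invariant :: "'w measure \<Rightarrow> ('w \<Rightarrow> cmat2 \<Rightarrow> complex) \<Rightarrow> bool" where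
  "strongly_bi_invariant M X \<longleftrightarrow>
     (\<forall>g\<in>SU2. \<forall>g'\<in>SU2. field_law M (\<lambda>\<omega> x. X \<omega> (matrix_inv g ** x ** g')) = field_law M X)"

definition two_weakly_bi_invariant :: "'w measure \<Rightarrow> ('w \<Rightarrow> cmat2 \<Rightarrow> complex) \<Rightarrow> bool" where
  "two_weakly_bi_invariant M X \<longleftrightarrow>
     (\<forall>g\<in>SU2. integrable M (\<lambda>\<omega>. (cmod (X \<omega> g))\<^sup>2)) \<and>
     (\<forall>h\<in>SU2. \<forall>h'\<in>SU2.
        (\<forall>g\<in>SU2. (\<integral>\<omega>. X \<omega> (h ** g ** h') \<partial>M) = (\<integral>\<omega>. X \<omega> g \<partial>M)) \<and>
        (\<forall>g1\<in>SU2. \<forall>g2\<in>SU2.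
           (\<integral>\<omega>. X \<omega> (h ** g1 ** h') * X \<omega> (h ** g2 ** h') \<partial>M) = (\<integral>\<omega>. X \<omega> g1 * X \<omega> g2 \<partial>M) \<and>
           (\<integral>\<omega>. X \<omega> (h ** g1 ** h') * cnj (X \<omega> (h ** g2 ** h')) \<partial>M) =
           (\<integral>\<omega>. X \<omega> g1 * cnj (X \<omega> g2) \<partial>M)))"


subsection \<open>Spectral probabilities\<close>

text \<open>The coefficient of \<open>wigner_phi l m s\<close> in the expansion of \<open>f\<close> in the orthonormal basis.\<close>
definition wigner_coeff :: "(cmat2 \<Rightarrow> complex) \<Rightarrow> real \<Rightarrow> real \<Rightarrow> real \<Rightarrow> complex" where
  "wigner_coeff f l m s = (\<integral>g. f g * cnj (wigner_phi l m s g) \<partial>su2_measure)"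

definition spectral_index :: "(real \<times> real \<times> real) set" where
  "spectral_index = {(l, m, s). l \<in> half_nats \<and> m \<in> weights l \<and> s \<in> weights l}"

definition weak_spectral :: "'w measure \<Rightarrow> ('w \<Rightarrow> cmat2 \<Rightarrow> complex) \<Rightarrow> (real \<times> real \<times> real) measure" where
  "weak_spectral M X = point_measure spectral_index
     (\<lambda>(l, m, s). ennreal ((\<integral>\<omega>. (cmod (wigner_coeff (X \<omega>) l m s))\<^sup>2 \<partial>M) / (\<integral>\<omega>. (su2_norm (X \<omega>))\<^sup>2 \<partial>M)))"

definition strong_spectral :: "'w measure \<Rightarrow> ('w \<Rightarrow> cmat2 \<Rightarrow> complex) \<Rightarrow> (real \<times> real \<times> real) measure" where
  "strong_spectral M X = point_measure spectral_index
     (\<lambda>(l, m, s). ennreal (\<integral>\<omega>. (cmod (wigner_coeff (X \<omega>) l m s))\<^sup>2 / (su2_norm (X \<omega>))\<^sup>2 \<partial>M))"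

definition uniform_on_levels :: "(real \<times> real \<times> real) measure \<Rightarrow> bool" where
  "uniform_on_levels \<mu> \<longleftrightarrow>
     (\<forall>l\<in>half_nats. \<exists>c. \<forall>m\<in>weights l. \<forall>s\<in>weights l. emeasure \<mu> {(l, m, s)} = c)"


subsection \<open>Consistency of the definitions\<close>

lemma weights_half: "weights (real n / 2) = (\<lambda>k. real k - real n / 2) ` {..n}"
  unfolding weights_def by (auto simp: image_iff)

lemma wigner_psi_half:
  assumes "k \<le> n"
  shows "wigner_psi (real n / 2) (real k - real n / 2) z0 z1 =
    of_real (sqrt (real (n choose k))) * z0 ^ k * z1 ^ (n - k)"
proof -
  have "real n / 2 - (real k - real n / 2) = real (n - k)" using assms by (simp add: of_nat_diff)
  then show ?thesis by (simp add: wigner_psi_def del: of_nat_diff)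
qed

lemma homogeneous_expansion:
  fixes a b c d :: complex
  shows "\<exists>e. \<forall>z0 z1. (a * z0 + b * z1) ^ p * (c * z0 + d * z1) ^ q =
    (\<Sum>k\<le>p + q. e k * z0 ^ k * z1 ^ (p + q - k))"
proof -
  have step: "\<exists>e'. \<forall>z0 z1. (u * z0 + v * z1) * (\<Sum>k\<le>n. e k * z0 ^ k * z1 ^ (n - k)) =
    (\<Sum>k\<le>Suc n. e' k * z0 ^ k * z1 ^ (Suc n - k))" for u v :: complex and e n
  proof (intro exI allI)
    fix z0 z1 :: complex
    let ?e = "\<lambda>k. (if k = 0 then 0 else u * e (k - 1)) + (if k = Suc n then 0 else v * e k)"
    have 1: "(\<Sum>k\<le>Suc n. (if k = 0 then 0 else u * e (k - 1)) * z0 ^ k * z1 ^ (Suc n - k)) =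
        u * z0 * (\<Sum>k\<le>n. e k * z0 ^ k * z1 ^ (n - k))"
      by (subst sum.atMost_Suc_shift) (simp add: sum_distrib_left mult_ac)
    have 2: "(\<Sum>k\<le>Suc n. (if k = Suc n then 0 else v * e k) * z0 ^ k * z1 ^ (Suc n - k)) =
        v * z1 * (\<Sum>k\<le>n. e k * z0 ^ k * z1 ^ (n - k))"
      by (simp add: sum_distrib_left mult_ac Suc_diff_le)
    show "(u * z0 + v * z1) * (\<Sum>k\<le>n. e k * z0 ^ k * z1 ^ (n - k)) =
        (\<Sum>k\<le>Suc n. ?e k * z0 ^ k * z1 ^ (Suc n - k))"
      unfolding distrib_right sum.distrib 1 2 ..
  qed
  show ?thesis
  proof (induction p)
    case 0
    show ?case
    proof (induction q)
      case 0
      show ?case by (rule exI[of _ "\<lambda>_. 1"]) simp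
    next
      case (Suc q)
      then obtain e where e: "\<forall>z0 z1. (c * z0 + d * z1) ^ q = (\<Sum>k\<le>q. e k * z0 ^ k * z1 ^ (q - k))"
        by auto
      then show ?case using step[of c d e q] by simp
    qed
  next
    case (Suc p)
    then obtain e where e: "\<forall>z0 z1. (a * z0 + b * z1) ^ p * (c * z0 + d * z1) ^ q =
      (\<Sum>k\<le>p + q. e k * z0 ^ k * z1 ^ (p + q - k))" by blast
    then show ?case using step[of a b e "p + q"] by (simp add: mult.assoc)
  qed
qed

lemma wigner_D_ex1:
  assumes "l \<in> half_nats" "s \<in> weights l"
  shows "\<exists>!d. is_wigner_column l s g d"
proof -
  obtain n where l: "l = real n / 2" using assms(1) by (auto simp: half_nats_def)
  obtain j where j: "j \<le> n" "s = real j - real n / 2" using assms(2) unfolding l weights_half by auto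
  let ?w = "\<lambda>k. real k - real n / 2"
  let ?r = "\<lambda>k. complex_of_real (sqrt (real (n choose k)))"
  have r: "?r k \<noteq> 0" if "k \<le> n" for k using that by simp
  have S: "(\<Sum>m\<in>weights l. wigner_psi l m z0 z1 * d m) =
      (\<Sum>k\<le>n. (?r k * d (?w k)) * z0 ^ k * z1 ^ (n - k))" for d z0 z1
    unfolding l weights_half
    by (subst sum.reindex) (auto simp: inj_on_def wigner_psi_half mult_ac intro!: sum.cong)
  obtain e where e: "\<And>z0 z1. (cnj (g $ 1 $ 1) * z0 + cnj (g $ 2 $ 1) * z1) ^ j *
      (- (g $ 2 $ 1) * z0 + g $ 1 $ 1 * z1) ^ (n - j) = (\<Sum>k\<le>n. e k * z0 ^ k * z1 ^ (n - k))"
    using homogeneous_expansion[of "cnj (g $ 1 $ 1)" "cnj (g $ 2 $ 1)" j "- (g $ 2 $ 1)" "g $ 1 $ 1" "n - j"] j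
    by auto
  have R: "wigner_psi l s (cnj (g $ 1 $ 1) * z0 + cnj (g $ 2 $ 1) * z1) (- (g $ 2 $ 1) * z0 + g $ 1 $ 1 * z1)
      = (\<Sum>k\<le>n. (?r j * e k) * z0 ^ k * z1 ^ (n - k))" for z0 z1
    unfolding l j(2) wigner_psi_half[OF j(1)] mult.assoc e by (simp add: sum_distrib_left mult_ac)
  have key: "is_wigner_column l s g d \<longleftrightarrow>
      (\<forall>m. m \<notin> weights l \<longrightarrow> d m = 0) \<and> (\<forall>k\<le>n. ?r k * d (?w k) = ?r j * e k)" for d
  proof -
    have "(\<forall>k\<le>n. ?r k * d (?w k) = ?r j * e k)"
      if "\<forall>z0 z1. (\<Sum>k\<le>n. (?r k * d (?w k)) * z0 ^ k * z1 ^ (n - k)) =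
        (\<Sum>k\<le>n. (?r j * e k) * z0 ^ k * z1 ^ (n - k))"
    proof -
      have "\<forall>z. (\<Sum>k\<le>n. (?r k * d (?w k)) * z ^ k) = (\<Sum>k\<le>n. (?r j * e k) * z ^ k)"
        using that[rule_format, of _ 1] by simp
      then show ?thesis unfolding polyfun_eq_coeffs .
    qed
    then show ?thesis unfolding is_wigner_column_def S R by (auto intro!: sum.cong)
  qed
  show ?thesis
  proof (rule ex1I)
    let ?d = "\<lambda>m. if m \<in> weights l then ?r j * e (nat \<lfloor>m + l\<rfloor>) / ?r (nat \<lfloor>m + l\<rfloor>) else 0"
    show "is_wigner_column l s g ?d"
      unfolding key using r by (auto simp: l weights_half)
  next
    let ?d = "\<lambda>m. if m \<in> weights l then ?r j * e (nat \<lfloor>m + l\<rfloor>) / ?r (nat \<lfloor>m + l\<rfloor>) else 0"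
    fix d assume d: "is_wigner_column l s g d"
    show "d = ?d"
    proof
      fix m
      show "d m = ?d m"
      proof (cases "m \<in> weights l")
        case True
        then obtain k where k: "k \<le> n" "m = ?w k" unfolding l weights_half by auto
        then have "?r k * d m = ?r j * e k" "nat \<lfloor>m + l\<rfloor> = k" using d unfolding key by (auto simp: l)
        then show ?thesis using True r[OF k(1)] by (auto simp: field_simps)
      next
        case False
        then show ?thesis using d unfolding key by simp
      qed
    qed
  qed
qed

lemma space_su2_measure [simp]: "space su2_measure = SU2"
  and sets_su2_measure [simp, measurable_cong]: "sets su2_measure = sets (restrict_space borel SU2)"
  by (simp_all add: su2_measure_def space_restrict_space space_scale_measure)

lemma su2_mat_nth [simp]:
  "su2_mat \<alpha> \<beta> $ 1 $ 1 = \<alpha>" "su2_mat \<alpha> \<beta> $ 1 $ 2 = - cnj \<beta>"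
  "su2_mat \<alpha> \<beta> $ 2 $ 1 = \<beta>" "su2_mat \<alpha> \<beta> $ 2 $ 2 = cnj \<alpha>"
  by (simp_all add: su2_mat_def)

lemma su2_mat_radial:
  assumes "z \<noteq> 0"
  shows "su2_mat (fst z / of_real (norm z)) (snd z / of_real (norm z)) \<in> SU2"
proof -
  have n: "(cmod (fst z))\<^sup>2 + (cmod (snd z))\<^sup>2 = (norm z)\<^sup>2" "norm z \<noteq> 0"
    using assms by (simp_all add: norm_prod_def prod_eq_iff)
  then have "(cmod (fst z / of_real (norm z)))\<^sup>2 + (cmod (snd z / of_real (norm z)))\<^sup>2 = 1"
    by (simp add: norm_divide power_divide flip: add_divide_distrib)
  then show ?thesis unfolding SU2_def by blast
qed

lemma measurable_su2_mat [measurable]: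
  "(\<lambda>z. su2_mat (fst z) (snd z)) \<in> borel_measurable borel"
proof -
  have ij: "continuous_on UNIV (\<lambda>z. su2_mat (fst z) (snd z) $ i $ j)" for i j
    using exhaust_2[of i] exhaust_2[of j] by (elim disjE)
      (simp_all add: continuous_on_fst continuous_on_snd continuous_on_cnj continuous_on_minus)
  have "continuous_on UNIV (\<lambda>z. su2_mat (fst z) (snd z))"
    using continuous_on_vec_lambda[OF continuous_on_vec_lambda[OF ij],
        of "\<lambda>i j. i" "\<lambda>i j. j"] by simp
  then show ?thesis by (rule borel_measurable_continuous_onI)
qed

lemma measurable_su2_mat_radial:
  "(\<lambda>z. su2_mat (fst z / of_real (norm z)) (snd z / of_real (norm z)))
     \<in> restrict_space lborel (ball (0 :: complex \<times> complex) 2 - {0}) \<rightarrow>\<^sub>M restrict_space borel SU2"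
proof (rule measurable_restrict_space2)
  show "(\<lambda>z. su2_mat (fst z / of_real (norm z)) (snd z / of_real (norm z)))
     \<in> space (restrict_space lborel (ball (0 :: complex \<times> complex) 2 - {0})) \<rightarrow> SU2"
    by (auto simp: space_restrict_space intro: su2_mat_radial)
  have "(\<lambda>z :: complex \<times> complex. (fst z / of_real (norm z), snd z / of_real (norm z)))
      \<in> borel \<rightarrow>\<^sub>M borel"
    by (intro borel_measurable_Pair borel_measurable_divide borel_measurable_of_real
        borel_measurable_continuous_onI continuous_intros)
  from measurable_compose[OF this measurable_su2_mat]
  show "(\<lambda>z. su2_mat (fst z / of_real (norm z)) (snd z / of_real (norm z)))
     \<in> borel_measurable (restrict_space lborel (ball (0 :: complex \<times> complex) 2 - {0}))"
    by (intro measurable_restrict_space1) simp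
qed

lemma emeasure_su2_measure: "emeasure su2_measure SU2 = ennreal (16 * pi\<^sup>2)"
proof -
  let ?B = "ball (0 :: complex \<times> complex) 2"
  let ?R = "restrict_space lborel (?B - {0})"
  let ?f = "\<lambda>z :: complex \<times> complex. su2_mat (fst z / of_real (norm z)) (snd z / of_real (norm z))"
  have "?f -` SU2 \<inter> space ?R = ?B - {0}"
    by (auto simp: space_restrict_space intro: su2_mat_radial)
  moreover have "SU2 \<in> sets (restrict_space borel SU2)"
    by (metis sets.top space_borel space_restrict_space Int_UNIV_right)
  ultimately have "emeasure su2_measure SU2 = 2 * emeasure ?R (?B - {0})"
    unfolding su2_measure_def
    by (simp add: emeasure_distr[OF measurable_su2_mat_radial])
  also have "emeasure ?R (?B - {0}) = emeasure lborel (?B - {0})"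
    by (subst emeasure_restrict_space) auto
  also have "\<dots> = emeasure lborel ?B"
    by (rule emeasure_Diff_null_set) auto
  also have "\<dots> = ennreal (unit_ball_vol 4 * 2 ^ 4)"
    by (subst emeasure_ball) auto
  also have "2 * \<dots> = ennreal (16 * pi\<^sup>2)"
    using unit_ball_vol_numeral(1)[of "num.Bit0 num.One"]
    by (simp add: fact_numeral flip: ennreal_numeral ennreal_mult)
  finally show ?thesis .
qed

end

theory Submission
  imports Defs
begin

text \<open>
  Translating the field by a group element acts on the matrix of its coefficients at level \<open>\<ell>\<close> through
  the Wigner matrices. Invariance therefore makes the Gram form \<open>C\<close> of a column (or row) of
  coefficients satisfy \<open>C = cnj D(k) C D(k)\<^sup>T\<close> for all \<open>k\<close>. Diagonal \<open>k\<close> force \<open>C\<close> to be diagonal, and the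
  relation between the extreme column and the extreme row of \<open>D\<close> at one element with nonzero entries
  then makes its diagonal constant.

  In the weak case \<open>C = E(a cnj a')\<close> is an integral of the covariance function, by Fubini. In the strong
  case \<open>C = E(a cnj a' / \<parallel>X\<parallel>\<^sup>2)\<close>, and one has to see that finite-dimensional distributions determine it:
  for the truncated field, \<open>1 / \<parallel>X\<parallel>\<^sup>2\<close> is a geometric series in powers of an integral over the group, so
  that Fubini applies term by term, and the truncation is removed by dominated convergence.
\<close>

subsection \<open>Wigner matrices\<close>

text \<open>An event of the product sigma-algebra depends on only countably many points of the
  group, so the norm and the coefficients of a path are in general not measurable functions on the
  space carrying \<open>field_law\<close>, and equality of laws cannot simply be pushed forward
  through them. Joint measurability of the field is what gives access to them: after Fubini, only
  field values at a fixed group element remain inside the expectation. Everything in the strong case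
  is therefore brought into the form of products of group integrals of bounded functions of the
  field. The geometric series for the inverse of the squared norm needs an upper bound on that norm;
  truncating values at \<open>n\<close> supplies it, namely \<open>n\<^sup>2\<close> times the
  volume \<open>16 * pi\<^sup>2\<close>. Both limits are then dominated through one inequality, that
  a squared coefficient is at most a constant times the squared norm. In the Schur argument the
  extreme row and column are chosen because their entries are explicit monomials in the entries of
  the group element, so that their conjugacy at inverse elements can be read off.\<close>

definition binom_root :: "nat \<Rightarrow> nat \<Rightarrow> complex" where
  "binom_root n k = of_real (sqrt (real (n choose k)))"

text \<open>With \<open>n = 2 l\<close>, \<open>k = l + m\<close>, \<open>j = l + s\<close> all
  half-integers become naturals, and column \<open>j\<close> becomes, up to the factors
  \<open>binom_root\<close>, the coefficient list of a polynomial.\<close>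

definition wigner_mat :: "nat \<Rightarrow> nat \<Rightarrow> nat \<Rightarrow> cmat2 \<Rightarrow> complex" where
  "wigner_mat n k j g = wigner_D (real n / 2) (real k - real n / 2) (real j - real n / 2) g"

lemma binom_root_nonzero: "k \<le> n \<Longrightarrow> binom_root n k \<noteq> 0"
  by (simp add: binom_root_def)

lemma binom_root_square: "binom_root n k * binom_root n k = of_nat (n choose k)"
  by (simp add: binom_root_def flip: of_real_mult)

lemma cnj_binom_root [simp]: "cnj (binom_root n k) = binom_root n k"
  by (simp add: binom_root_def)

lemma wigner_mat_sum:
  assumes "j \<le> n"
  shows "(\<Sum>k\<le>n. binom_root n k * wigner_mat n k j g * z0 ^ k * z1 ^ (n - k)) =
    binom_root n j * (cnj (g $ 1 $ 1) * z0 + cnj (g $ 2 $ 1) * z1) ^ j *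
      (- (g $ 2 $ 1) * z0 + g $ 1 $ 1 * z1) ^ (n - j)"
proof -
  let ?l = "real n / 2" and ?s = "real j - real n / 2"
  have "?l \<in> half_nats" "?s \<in> weights ?l"
    using assms by (auto simp: half_nats_def weights_half)
  then have "is_wigner_column ?l ?s g (THE d. is_wigner_column ?l ?s g d)"
    by (rule theI'[OF wigner_D_ex1])
  then have "is_wigner_column ?l ?s g (\<lambda>m. wigner_D ?l m ?s g)"
    by (simp only: wigner_D_def)
  from this[unfolded is_wigner_column_def, THEN conjunct2, rule_format]
  have "(\<Sum>m\<in>weights ?l. wigner_psi ?l m z0 z1 * wigner_D ?l m ?s g) =
      wigner_psi ?l ?s (cnj (g $ 1 $ 1) * z0 + cnj (g $ 2 $ 1) * z1)
        (- (g $ 2 $ 1) * z0 + g $ 1 $ 1 * z1)"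
    .
  moreover have "(\<Sum>m\<in>weights ?l. wigner_psi ?l m z0 z1 * wigner_D ?l m ?s g) =
      (\<Sum>k\<le>n. binom_root n k * wigner_mat n k j g * z0 ^ k * z1 ^ (n - k))"
    unfolding weights_half
    by (subst sum.reindex)
      (auto simp: inj_on_def wigner_psi_half binom_root_def wigner_mat_def mult_ac intro!: sum.cong)
  ultimately show ?thesis
    by (simp add: wigner_psi_half[OF assms] binom_root_def)
qed

text \<open>The defining identity is homogeneous of degree \<open>n\<close>, so setting
  \<open>z1 = 1\<close> loses nothing, and comparing coefficients in \<open>z\<close> recovers each
  entry. The product rule and the explicit entries rest on this.\<close>

lemma wigner_mat_unique:
  assumes "j \<le> n" "k \<le> n"
    and d: "\<And>z. (\<Sum>k\<le>n. binom_root n k * d k * z ^ k) =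
      binom_root n j * (cnj (g $ 1 $ 1) * z + cnj (g $ 2 $ 1)) ^ j *
      (- (g $ 2 $ 1) * z + g $ 1 $ 1) ^ (n - j)"
  shows "wigner_mat n k j g = d k"
proof -
  have "\<forall>z. (\<Sum>k\<le>n. (binom_root n k * wigner_mat n k j g) * z ^ k) =
      (\<Sum>k\<le>n. (binom_root n k * d k) * z ^ k)"
    using wigner_mat_sum[OF assms(1), of g _ 1] d by simp
  then show ?thesis
    unfolding polyfun_eq_coeffs using assms(2) binom_root_nonzero[of k n] by auto
qed

text \<open>The substitution belonging to \<open>g ** h\<close> is that of \<open>h\<close> after
  that of \<open>g\<close>: the identity for \<open>h\<close> is taken at \<open>(w0, w1)\<close>,
  then each monomial is expanded by the identity for \<open>g\<close>. Membership of
  \<open>g\<close> in the group supplies its second column, which enters the first column of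
  \<open>g ** h\<close>.\<close>

lemma wigner_mat_mult:
  assumes "g \<in> SU2" "j \<le> n" "k \<le> n"
  shows "wigner_mat n k j (g ** h) = (\<Sum>p\<le>n. wigner_mat n k p g * wigner_mat n p j h)"
proof (rule wigner_mat_unique[OF assms(2,3)])
  fix z
  define w0 where "w0 = cnj (g $ 1 $ 1) * z + cnj (g $ 2 $ 1)"
  define w1 where "w1 = - (g $ 2 $ 1) * z + g $ 1 $ 1"
  obtain a b where g: "g = su2_mat a b" using assms(1) by (auto simp: SU2_def)
  have "cnj ((g ** h) $ 1 $ 1) * z + cnj ((g ** h) $ 2 $ 1) = cnj (h $ 1 $ 1) * w0 + cnj (h $ 2 $ 1) * w1"
    and "- ((g ** h) $ 2 $ 1) * z + (g ** h) $ 1 $ 1 = - (h $ 2 $ 1) * w0 + h $ 1 $ 1 * w1"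
    by (simp_all add: matrix_matrix_mult_def sum_2 g w0_def w1_def algebra_simps)
  then have "binom_root n j * (cnj ((g ** h) $ 1 $ 1) * z + cnj ((g ** h) $ 2 $ 1)) ^ j *
      (- ((g ** h) $ 2 $ 1) * z + (g ** h) $ 1 $ 1) ^ (n - j) =
      (\<Sum>p\<le>n. wigner_mat n p j h * (binom_root n p * w0 ^ p * w1 ^ (n - p)))"
    using wigner_mat_sum[OF assms(2), of h w0 w1] by (simp add: mult_ac)
  also have "\<dots> = (\<Sum>p\<le>n. wigner_mat n p j h * (\<Sum>k\<le>n. binom_root n k * wigner_mat n k p g * z ^ k))"
    using wigner_mat_sum[of _ n g z 1] by (simp add: w0_def w1_def)
  also have "\<dots> = (\<Sum>k\<le>n. binom_root n k * (\<Sum>p\<le>n. wigner_mat n k p g * wigner_mat n p j h) * z ^ k)"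
    unfolding sum_distrib_left sum_distrib_right by (subst sum.swap) (simp add: mult_ac)
  finally show "(\<Sum>k\<le>n. binom_root n k * (\<Sum>p\<le>n. wigner_mat n k p g * wigner_mat n p j h) * z ^ k) =
    binom_root n j * (cnj ((g ** h) $ 1 $ 1) * z + cnj ((g ** h) $ 2 $ 1)) ^ j *
      (- ((g ** h) $ 2 $ 1) * z + (g ** h) $ 1 $ 1) ^ (n - j)" ..
qed

lemma wigner_mat_diag:
  assumes "j \<le> n" "k \<le> n"
  shows "wigner_mat n k j (su2_mat u 0) = (if k = j then cnj u ^ j * u ^ (n - j) else 0)"
proof (rule wigner_mat_unique[OF assms])
  fix z
  have "(\<Sum>k\<le>n. binom_root n k * (if k = j then cnj u ^ j * u ^ (n - j) else 0) * z ^ k) =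
      (\<Sum>k\<le>n. if k = j then binom_root n j * (cnj u ^ j * u ^ (n - j)) * z ^ j else 0)"
    by (intro sum.cong) auto
  also have "\<dots> = binom_root n j * (cnj u ^ j * u ^ (n - j)) * z ^ j"
    using assms(1) by simp
  finally show "(\<Sum>k\<le>n. binom_root n k * (if k = j then cnj u ^ j * u ^ (n - j) else 0) * z ^ k) =
    binom_root n j * (cnj (su2_mat u 0 $ 1 $ 1) * z + cnj (su2_mat u 0 $ 2 $ 1)) ^ j *
      (- (su2_mat u 0 $ 2 $ 1) * z + su2_mat u 0 $ 1 $ 1) ^ (n - j)"
    by (simp add: power_mult_distrib mult_ac)
qed

text \<open>For \<open>j = n\<close> the second linear factor has exponent 0, and the binomial
  theorem gives all coefficients; one of the two square roots of the binomial coefficient is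
  absorbed by the normalisation.\<close>

lemma wigner_mat_last_column:
  assumes "k \<le> n"
  shows "wigner_mat n k n (su2_mat a b) = binom_root n k * cnj a ^ k * cnj b ^ (n - k)"
proof (rule wigner_mat_unique[OF order.refl assms])
  fix z
  have "(\<Sum>k\<le>n. binom_root n k * (binom_root n k * cnj a ^ k * cnj b ^ (n - k)) * z ^ k) =
      (\<Sum>k\<le>n. of_nat (n choose k) * (cnj a * z) ^ k * cnj b ^ (n - k))"
    unfolding power_mult_distrib binom_root_square[symmetric] by (simp only: mult_ac)
  then show "(\<Sum>k\<le>n. binom_root n k * (binom_root n k * cnj a ^ k * cnj b ^ (n - k)) * z ^ k) =
    binom_root n n * (cnj (su2_mat a b $ 1 $ 1) * z + cnj (su2_mat a b $ 2 $ 1)) ^ n *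
      (- (su2_mat a b $ 2 $ 1) * z + su2_mat a b $ 1 $ 1) ^ (n - n)"
    by (simp add: binomial_ring binom_root_def[of n n])
qed

section \<open>Wigner entries as coefficients of products of linear powers, and their
  continuity\<close>

lemma degree_linear_power_le: "degree ([:x, y:] ^ m) \<le> m"
  using degree_power_le[of "[:x, y:]" m] by (rule order.trans) auto

lemma coeff_linear_power:
  fixes x y :: "'a :: comm_ring_1"
  shows "coeff ([:x, y:] ^ m) m = y ^ m"
proof (induction m)
  case (Suc m)
  then show ?case
    using degree_linear_power_le[of x y m] by (simp add: coeff_eq_0 coeff_pCons)
qed simp

text \<open>Replaces the definite description by a polynomial in the matrix entries and their
  conjugates. It serves the top coefficient in \<open>wigner_mat_last_row\<close> and continuity in
  \<open>g\<close>.\<close>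

lemma wigner_mat_eq_coeff:
  assumes "j \<le> n" "k \<le> n"
  shows "wigner_mat n k j g = binom_root n j / binom_root n k *
    coeff ([:cnj (g $ 2 $ 1), cnj (g $ 1 $ 1):] ^ j * [:g $ 1 $ 1, - (g $ 2 $ 1):] ^ (n - j)) k"
proof (rule wigner_mat_unique[OF assms])
  fix z
  let ?p = "[:cnj (g $ 2 $ 1), cnj (g $ 1 $ 1):]" and ?q = "[:g $ 1 $ 1, - (g $ 2 $ 1):]"
  have "degree (?p ^ j) \<le> j" "degree (?q ^ (n - j)) \<le> n - j"
    by (rule degree_linear_power_le)+
  then have "degree (?p ^ j * ?q ^ (n - j)) \<le> n"
    using degree_mult_le[of "?p ^ j" "?q ^ (n - j)"] assms(1) by linarith
  then have "poly (?p ^ j * ?q ^ (n - j)) z = (\<Sum>k\<le>n. coeff (?p ^ j * ?q ^ (n - j)) k * z ^ k)"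
    unfolding poly_altdef by (intro sum.mono_neutral_left) (auto simp: coeff_eq_0)
  then show "(\<Sum>k\<le>n. binom_root n k * (binom_root n j / binom_root n k * coeff (?p ^ j * ?q ^ (n - j)) k) * z ^ k) =
    binom_root n j * (cnj (g $ 1 $ 1) * z + cnj (g $ 2 $ 1)) ^ j *
      (- (g $ 2 $ 1) * z + g $ 1 $ 1) ^ (n - j)"
    using binom_root_nonzero by (simp add: sum_distrib_left mult_ac add.commute)
qed

text \<open>\<open>k = n\<close> selects the top coefficient, the product of the two leading ones.
  Passing to the inverse, from \<open>(a, b)\<close> to \<open>(cnj a, - b)\<close>, turns this row
  into the conjugate of the last column: this is the piece of unitarity that the Schur argument
  uses.\<close>

lemma wigner_mat_last_row:
  assumes "j \<le> n"
  shows "wigner_mat n n j (su2_mat a b) = binom_root n j * cnj a ^ j * (- b) ^ (n - j)"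
proof -
  let ?p = "[:cnj b, cnj a:]" and ?q = "[:a, - b:]"
  have "coeff (?p ^ j * ?q ^ (n - j)) (j + (n - j)) = coeff (?p ^ j) j * coeff (?q ^ (n - j)) (n - j)"
  proof -
    \<comment> \<open>Only \<open>i = j\<close> survives in the Cauchy product: a smaller
      \<open>i\<close> pushes the other index beyond the degree bound \<open>n - j\<close>, a larger
      one exceeds \<open>j\<close>.\<close>
    have "coeff (?p ^ j) i * coeff (?q ^ (n - j)) (j + (n - j) - i) =
        (if i = j then coeff (?p ^ j) j * coeff (?q ^ (n - j)) (n - j) else 0)" if "i \<le> j + (n - j)" for i
    proof (cases i j rule: linorder_cases)
      case less
      then have "coeff (?q ^ (n - j)) (j + (n - j) - i) = 0"
        using degree_linear_power_le[of a "- b" "n - j"] by (intro coeff_eq_0) linarith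
      with less show ?thesis by simp
    next
      case greater
      then have "coeff (?p ^ j) i = 0" using degree_linear_power_le[of "cnj b" "cnj a" j] by (intro coeff_eq_0) linarith
      with greater show ?thesis by simp
    qed simp
    then show ?thesis unfolding coeff_mult by simp
  qed
  then show ?thesis
    using assms by (simp add: wigner_mat_eq_coeff coeff_linear_power binom_root_def[of n n])
qed

lemma continuous_on_coeff_mult:
  fixes p q :: "'a :: topological_space \<Rightarrow> complex poly"
  assumes "\<And>k. continuous_on S (\<lambda>x. coeff (p x) k)" "\<And>k. continuous_on S (\<lambda>x. coeff (q x) k)"
  shows "continuous_on S (\<lambda>x. coeff (p x * q x) k)"
  unfolding coeff_mult by (intro continuous_intros assms)

lemma continuous_on_coeff_power:
  fixes p :: "'a :: topological_space \<Rightarrow> complex poly"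
  assumes "\<And>k. continuous_on S (\<lambda>x. coeff (p x) k)"
  shows "continuous_on S (\<lambda>x. coeff (p x ^ m) k)"
  by (induction m arbitrary: k) (simp_all add: assms continuous_on_coeff_mult)

lemma continuous_on_wigner_mat:
  assumes "j \<le> n" "k \<le> n"
  shows "continuous_on S (wigner_mat n k j)"
proof -
  have lin: "continuous_on S (\<lambda>g. coeff [:x g, y g:] i)"
    if "continuous_on S x" "continuous_on S y" for x y :: "cmat2 \<Rightarrow> complex" and i
    using that by (cases i; cases "i - 1") (auto simp: coeff_pCons)
  have "continuous_on S (\<lambda>g. coeff ([:cnj (g $ 2 $ 1), cnj (g $ 1 $ 1):] ^ j *
      [:g $ 1 $ 1, - (g $ 2 $ 1):] ^ (n - j)) k)"
    by (intro continuous_on_coeff_mult continuous_on_coeff_power lin continuous_intros)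
  then show ?thesis
    unfolding wigner_mat_eq_coeff[OF assms, abs_def] by (intro continuous_intros)
qed

subsection \<open>Bi-invariance of the volume measure\<close>

lemma su2_mat_mult: "su2_mat a b ** su2_mat c d = su2_mat (a * c - cnj b * d) (b * c + cnj a * d)"
  by (simp add: vec_eq_iff forall_2 matrix_matrix_mult_def sum_2)

lemma mat_1_eq_su2_mat: "mat 1 = su2_mat 1 0"
  by (simp add: vec_eq_iff forall_2 mat_def)

lemma su2_mat_in_SU2: "(cmod a)\<^sup>2 + (cmod b)\<^sup>2 = 1 \<Longrightarrow> su2_mat a b \<in> SU2"
  unfolding SU2_def by blast

lemma su2_mat_inverse:
  assumes "(cmod a)\<^sup>2 + (cmod b)\<^sup>2 = 1"
  shows "su2_mat a b ** su2_mat (cnj a) (- b) = mat 1"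
    and "su2_mat (cnj a) (- b) ** su2_mat a b = mat 1"
proof -
  have "complex_of_real ((cmod a)\<^sup>2 + (cmod b)\<^sup>2) = 1" using assms by simp
  then have "a * cnj a + b * cnj b = 1" by (simp add: complex_norm_square del: of_real_power)
  then show "su2_mat a b ** su2_mat (cnj a) (- b) = mat 1"
    and "su2_mat (cnj a) (- b) ** su2_mat a b = mat 1"
    by (simp_all add: su2_mat_mult mat_1_eq_su2_mat mult_ac)
qed

lemma SU2_inverse_exists:
  assumes "g \<in> SU2"
  shows "\<exists>h\<in>SU2. g ** h = mat 1 \<and> h ** g = mat 1"
proof -
  obtain a b where "g = su2_mat a b" "(cmod a)\<^sup>2 + (cmod b)\<^sup>2 = 1"
    using assms by (auto simp: SU2_def)
  then show ?thesis
    using su2_mat_inverse[of a b] su2_mat_in_SU2[of "cnj a" "- b"] by auto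
qed

section \<open>Shears, rotations and a reflection preserve Lebesgue measure on pairs of complex
  numbers\<close>

lemma lborel_distr_comp:
  assumes "distr lborel borel f = lborel" "distr lborel borel g = lborel"
    and [measurable]: "f \<in> borel_measurable borel" "g \<in> borel_measurable borel"
  shows "distr lborel borel (\<lambda>x. f (g x)) = lborel"
proof -
  have "distr (distr lborel borel g) borel f = distr lborel borel (\<lambda>x. f (g x))"
    by (subst distr_distr) (auto simp: comp_def)
  then show ?thesis using assms by simp
qed

lemma measurable_complex_pair:
  assumes "continuous_on UNIV f"
  shows "f \<in> borel_measurable (borel :: (complex \<times> complex) measure)"
  using assms by (rule borel_measurable_continuous_onI)

lemma emeasure_lborel_translate:
  fixes A :: "complex set"
  assumes "A \<in> sets borel"
  shows "emeasure lborel ((\<lambda>x. x + c) -` A) = emeasure lborel A"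
proof -
  have "emeasure lborel A = emeasure (distr lborel borel ((+) c)) A"
    by (simp add: lborel_distr_plus)
  also have "\<dots> = emeasure lborel ((+) c -` A)"
    using assms by (subst emeasure_distr) auto
  also have "(+) c = (\<lambda>x. x + c)" by (simp add: fun_eq_iff add.commute)
  finally show ?thesis ..
qed

text \<open>On the slice with second coordinate \<open>y\<close> the shear is translation by
  \<open>c * y\<close>; slicing the measure reduces the claim to translation invariance.\<close>

lemma lborel_shear_fst:
  fixes c :: complex
  shows "distr lborel borel (\<lambda>z. (fst z + c * snd z, snd z)) = lborel"
proof (rule measure_eqI)
  let ?T = "\<lambda>z. (fst z + c * snd z, snd z)"
  have m[measurable]: "?T \<in> borel_measurable borel"
    by (intro measurable_complex_pair continuous_intros)
  fix A assume "A \<in> sets (distr lborel borel ?T)"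
  then have A: "A \<in> sets borel" by simp
  then have TA: "?T -` A \<in> sets borel" using measurable_sets[OF m A] by simp
  have p: "X \<in> sets (lborel \<Otimes>\<^sub>M lborel)" if "X \<in> sets borel" for X :: "(complex \<times> complex) set"
    using that by (simp only: lborel_prod sets_lborel)
  have "emeasure (distr lborel borel ?T) A = emeasure (lborel \<Otimes>\<^sub>M lborel) (?T -` A)"
    using A by (simp add: emeasure_distr lborel_prod)
  also have "\<dots> = (\<integral>\<^sup>+y. emeasure lborel ((\<lambda>x. x + c * y) -` ((\<lambda>x. (x, y)) -` A)) \<partial>lborel)"
    by (subst lborel_pair.emeasure_pair_measure_alt2[OF p[OF TA]]) (simp add: vimage_def)
  also have "\<dots> = (\<integral>\<^sup>+y. emeasure lborel ((\<lambda>x. (x, y)) -` A) \<partial>lborel)"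
  proof (rule nn_integral_cong)
    fix y :: complex
    have "(\<lambda>x. (x, y)) -` A \<in> sets borel" using sets_Pair2[OF p[OF A], of y] by simp
    then show "emeasure lborel ((\<lambda>x. x + c * y) -` ((\<lambda>x. (x, y)) -` A)) =
        emeasure lborel ((\<lambda>x. (x, y)) -` A)"
      by (rule emeasure_lborel_translate)
  qed
  also have "\<dots> = emeasure lborel A"
    by (subst lborel_pair.emeasure_pair_measure_alt2[OF p[OF A], symmetric]) (simp add: lborel_prod)
  finally show "emeasure (distr lborel borel ?T) A = emeasure lborel A" .
qed simp

lemma lborel_shear_snd:
  fixes c :: complex
  shows "distr lborel borel (\<lambda>z. (fst z, snd z + c * fst z)) = lborel"
proof (rule measure_eqI)
  let ?T = "\<lambda>z. (fst z, snd z + c * fst z)"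
  have m[measurable]: "?T \<in> borel_measurable borel"
    by (intro measurable_complex_pair continuous_intros)
  fix A assume "A \<in> sets (distr lborel borel ?T)"
  then have A: "A \<in> sets borel" by simp
  then have TA: "?T -` A \<in> sets borel" using measurable_sets[OF m A] by simp
  have p: "X \<in> sets (lborel \<Otimes>\<^sub>M lborel)" if "X \<in> sets borel" for X :: "(complex \<times> complex) set"
    using that by (simp only: lborel_prod sets_lborel)
  have "emeasure (distr lborel borel ?T) A = emeasure (lborel \<Otimes>\<^sub>M lborel) (?T -` A)"
    using A by (simp add: emeasure_distr lborel_prod)
  also have "\<dots> = (\<integral>\<^sup>+x. emeasure lborel ((\<lambda>y. y + c * x) -` (Pair x -` A)) \<partial>lborel)"
    by (subst lborel.emeasure_pair_measure_alt[OF p[OF TA]]) (simp add: vimage_def)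
  also have "\<dots> = (\<integral>\<^sup>+x. emeasure lborel (Pair x -` A) \<partial>lborel)"
  proof (rule nn_integral_cong)
    fix x :: complex
    have "Pair x -` A \<in> sets borel" using sets_Pair1[OF p[OF A], of x] by simp
    then show "emeasure lborel ((\<lambda>y. y + c * x) -` (Pair x -` A)) = emeasure lborel (Pair x -` A)"
      by (rule emeasure_lborel_translate)
  qed
  also have "\<dots> = emeasure lborel A"
    by (subst lborel.emeasure_pair_measure_alt[OF p[OF A], symmetric]) (simp add: lborel_prod)
  finally show "emeasure (distr lborel borel ?T) A = emeasure lborel A" .
qed simp

text \<open>Left multiplication by \<open>su2_mat a b\<close>, acting on the first column
  \<open>(\<alpha>, \<beta>)\<close> of a group element and extended linearly to all pairs.\<close>

definition su2_act :: "complex \<Rightarrow> complex \<Rightarrow> complex \<times> complex \<Rightarrow> complex \<times> complex" where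
  "su2_act a b z = (a * fst z - cnj b * snd z, b * fst z + cnj a * snd z)"

lemma measurable_su2_act [measurable]: "su2_act a b \<in> borel_measurable borel"
  unfolding su2_act_def[abs_def] by (intro measurable_complex_pair continuous_intros)

text \<open>A matrix of determinant 1 is a product of elementary matrices, that is, of shears.\<close>
lemma lborel_su2_act:
  assumes ab: "(cmod a)\<^sup>2 + (cmod b)\<^sup>2 = 1"
  shows "distr lborel borel (su2_act a b) = lborel"
proof -
  have nonzero: "distr lborel borel (su2_act a b) = lborel"
    if ab: "(cmod a)\<^sup>2 + (cmod b)\<^sup>2 = 1" and "b \<noteq> 0" for a b
  proof -
    let ?S = "\<lambda>c z. (fst z + c * snd z, snd z :: complex)"
    let ?R = "\<lambda>z. (fst z, snd z + b * fst z)"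
    have "complex_of_real ((cmod a)\<^sup>2 + (cmod b)\<^sup>2) = 1" using ab by simp
    then have "b * cnj b = 1 - a * cnj a" by (simp add: complex_norm_square algebra_simps del: of_real_power)
    \<comment> \<open>The product of upper, lower and upper shears with parameters \<open>x\<close>,
      \<open>b\<close>, \<open>y\<close> has diagonal entries \<open>1 + b * x\<close> and
      \<open>1 + b * y\<close>. Matching them with \<open>a\<close> and \<open>cnj a\<close> fixes
      \<open>x\<close> and \<open>y\<close>; determinant 1 then forces the remaining entry.\<close>
    moreover define x y where "x = (a - 1) / b" and "y = (cnj a - 1) / b"
    then have bx: "b * x = a - 1" and "b * y = cnj a - 1"
      using \<open>b \<noteq> 0\<close> by simp_all
    ultimately have "b * (cnj b + a * y + x) = 0" by algebra
    then have cb: "cnj b + a * y + x = 0" using \<open>b \<noteq> 0\<close> by simp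
    have "su2_act a b z = ?S x (?R (?S y z))" for z
    proof (rule prod_eqI)
      show "fst (su2_act a b z) = fst (?S x (?R (?S y z)))"
        unfolding su2_act_def fst_conv snd_conv using bx cb by algebra
      show "snd (su2_act a b z) = snd (?S x (?R (?S y z)))"
        unfolding su2_act_def fst_conv snd_conv using \<open>b * y = cnj a - 1\<close> by algebra
    qed
    then have "su2_act a b = (\<lambda>z. ?S x (?R (?S y z)))" by (rule ext)
    moreover have mS: "?S c \<in> borel_measurable borel" and mR: "?R \<in> borel_measurable borel" for c
      by (intro measurable_complex_pair continuous_intros)+
    ultimately show ?thesis
      by (simp only: lborel_distr_comp[OF lborel_shear_fst
            lborel_distr_comp[OF lborel_shear_snd lborel_shear_fst mR mS] mS measurable_compose[OF mS mR]])
  qed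
  show ?thesis
  proof (cases "b = 0")
    case True
    \<comment> \<open>A diagonal element is a product of two antidiagonal ones, each with nonzero
      second parameter, to which \<open>nonzero\<close> applies.\<close>
    then have "su2_act a b = (\<lambda>z. su2_act 0 (cnj a) (su2_act 0 (- 1) z))"
      by (simp add: su2_act_def fun_eq_iff)
    moreover have "a \<noteq> 0" using ab True by auto
    moreover have "distr lborel borel (\<lambda>z. su2_act 0 (cnj a) (su2_act 0 (- 1) z)) = lborel"
    proof (rule lborel_distr_comp[OF _ _ measurable_su2_act measurable_su2_act])
      show "distr lborel borel (su2_act 0 (cnj a)) = lborel"
        using True ab \<open>a \<noteq> 0\<close> by (intro nonzero) auto
      show "distr lborel borel (su2_act 0 (- 1)) = lborel" by (intro nonzero) auto
    qed
    ultimately show ?thesis by simp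
  qed (use nonzero ab in blast)
qed

text \<open>The map takes the first column \<open>(\<alpha>, \<beta>)\<close> of
  \<open>su2_mat \<alpha> \<beta>\<close> to its first row, on which right translations act complex
  linearly.\<close>

lemma lborel_reflect:
  "distr lborel borel (\<lambda>z :: complex \<times> complex. (fst z, - cnj (snd z))) = lborel"
proof -
  \<comment> \<open>\<open>(0, 1)\<close> is the real direction of the second coordinate, the only
    one whose sign \<open>- cnj\<close> changes.\<close>
  define c where "c j = (if j = (0, 1) then - 1 else 1 :: real)" for j :: "complex \<times> complex"
  have "(\<Sum>j\<in>Basis. (c j * (z \<bullet> j)) *\<^sub>R j) = (fst z, - cnj (snd z))" for z :: "complex \<times> complex"
  proof (rule euclidean_eqI)
    fix b :: "complex \<times> complex" assume b: "b \<in> Basis"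
    then have "(\<Sum>j\<in>Basis. (c j * (z \<bullet> j)) *\<^sub>R j) \<bullet> b = c b * (z \<bullet> b)"
      by simp
    also have "\<dots> = (fst z, - cnj (snd z)) \<bullet> b"
      using b by (auto simp: Basis_prod_def Basis_complex_def c_def inner_prod_def)
    finally show "(\<Sum>j\<in>Basis. (c j * (z \<bullet> j)) *\<^sub>R j) \<bullet> b = (fst z, - cnj (snd z)) \<bullet> b" .
  qed
  moreover have "(\<Prod>j\<in>Basis. \<bar>c j\<bar>) = 1" by (intro prod.neutral) (simp add: c_def)
  ultimately show ?thesis
    using lborel_affine_euclidean[of c 0] by (simp add: c_def density_1)
qed

section \<open>From Lebesgue measure on the punctured ball to the volume of the group\<close>

definition su2_proj :: "complex \<times> complex \<Rightarrow> cmat2" where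
  "su2_proj z = su2_mat (fst z / of_real (norm z)) (snd z / of_real (norm z))"

lemma su2_proj_in_SU2: "z \<noteq> 0 \<Longrightarrow> su2_proj z \<in> SU2"
  unfolding su2_proj_def by (rule su2_mat_radial)

lemma emeasure_su2_measure_eq:
  assumes A: "A \<in> sets su2_measure"
  shows "{z \<in> ball 0 2 - {0}. su2_proj z \<in> A} \<in> sets borel"
    and "emeasure su2_measure A = 2 * emeasure lborel {z \<in> ball 0 2 - {0}. su2_proj z \<in> A}"
proof -
  let ?B = "ball (0 :: complex \<times> complex) 2 - {0}"
  let ?R = "restrict_space lborel ?B"
  have A': "A \<in> sets (restrict_space borel SU2)" using A by simp
  have B: "?B \<in> sets borel" by auto
  have m: "su2_proj \<in> ?R \<rightarrow>\<^sub>M restrict_space borel SU2"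
    using measurable_su2_mat_radial by (simp add: su2_proj_def[abs_def])
  have eq: "su2_proj -` A \<inter> space ?R = {z \<in> ?B. su2_proj z \<in> A}"
    by (auto simp: space_restrict_space)
  have "{z \<in> ?B. su2_proj z \<in> A} \<in> sets ?R"
    using measurable_sets[OF m A'] unfolding eq .
  then show "{z \<in> ?B. su2_proj z \<in> A} \<in> sets borel"
    using B by (subst (asm) sets_restrict_space_iff) auto
  have "emeasure su2_measure A = 2 * emeasure ?R (su2_proj -` A \<inter> space ?R)"
    unfolding su2_measure_def su2_proj_def[symmetric]
    by (simp add: emeasure_distr[OF m A'])
  also have "\<dots> = 2 * emeasure lborel {z \<in> ?B. su2_proj z \<in> A}"
    unfolding eq using B by (subst emeasure_restrict_space) auto
  finally show "emeasure su2_measure A = 2 * emeasure lborel {z \<in> ?B. su2_proj z \<in> A}" .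
qed

text \<open>Since \<open>T\<close> preserves the norm, it maps the punctured ball to itself, and the
  cone over the preimage of \<open>A\<close> under \<tau> is the preimage under \<open>T\<close> of
  the cone over \<open>A\<close>. Invariance of Lebesgue measure thus descends to the
  sphere.\<close>

lemma distr_su2_measure:
  assumes T: "distr lborel borel T = lborel" "T \<in> borel_measurable borel"
    and norm: "\<And>z. norm (T z) = norm z"
    and \<tau>: "\<tau> \<in> su2_measure \<rightarrow>\<^sub>M su2_measure"
    and comm: "\<And>z. z \<noteq> 0 \<Longrightarrow> \<tau> (su2_proj z) = su2_proj (T z)"
  shows "distr su2_measure su2_measure \<tau> = su2_measure"
proof (rule measure_eqI)
  fix A assume "A \<in> sets (distr su2_measure su2_measure \<tau>)"
  then have A: "A \<in> sets su2_measure" by simp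
  let ?B = "ball (0 :: complex \<times> complex) 2 - {0}"
  have T0: "T z = 0 \<longleftrightarrow> z = 0" for z using norm[of z] by (metis norm_eq_zero)
  have "\<tau> -` A \<inter> space su2_measure \<in> sets su2_measure" by (rule measurable_sets[OF \<tau> A])
  then have "emeasure (distr su2_measure su2_measure \<tau>) A =
      2 * emeasure lborel {z \<in> ?B. su2_proj z \<in> \<tau> -` A \<inter> space su2_measure}"
    by (simp only: emeasure_distr[OF \<tau> A] emeasure_su2_measure_eq(2))
  also have "{z \<in> ?B. su2_proj z \<in> \<tau> -` A \<inter> space su2_measure} = T -` {z \<in> ?B. su2_proj z \<in> A}"
    using comm by (auto simp: norm T0 su2_proj_in_SU2)
  also have "emeasure lborel \<dots> = emeasure (distr lborel borel T) {z \<in> ?B. su2_proj z \<in> A}"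
    using emeasure_su2_measure_eq(1)[OF A] T(2) by (subst emeasure_distr) auto
  also have "2 * \<dots> = emeasure su2_measure A"
    by (simp only: T(1) emeasure_su2_measure_eq(2)[OF A])
  finally show "emeasure (distr su2_measure su2_measure \<tau>) A = emeasure su2_measure A" .
qed simp

lemma SU2_mult_closed: "g \<in> SU2 \<Longrightarrow> h \<in> SU2 \<Longrightarrow> g ** h \<in> SU2"
proof -
  assume "g \<in> SU2" "h \<in> SU2"
  then obtain a b c d where g: "g = su2_mat a b" "(cmod a)\<^sup>2 + (cmod b)\<^sup>2 = 1"
    and h: "h = su2_mat c d" "(cmod c)\<^sup>2 + (cmod d)\<^sup>2 = 1" by (auto simp: SU2_def)
  have "complex_of_real ((cmod (a * c - cnj b * d))\<^sup>2 + (cmod (b * c + cnj a * d))\<^sup>2) =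
      of_real (((cmod a)\<^sup>2 + (cmod b)\<^sup>2) * ((cmod c)\<^sup>2 + (cmod d)\<^sup>2))"
    by (simp add: complex_norm_square del: of_real_power) (simp add: algebra_simps)
  then have "(cmod (a * c - cnj b * d))\<^sup>2 + (cmod (b * c + cnj a * d))\<^sup>2 = 1"
    unfolding of_real_eq_iff g h by simp
  then show ?thesis by (simp add: g h su2_mat_mult su2_mat_in_SU2)
qed

lemma norm_su2_act:
  assumes "(cmod a)\<^sup>2 + (cmod b)\<^sup>2 = 1"
  shows "norm (su2_act a b z) = norm z"
proof -
  have "complex_of_real ((cmod (a * fst z - cnj b * snd z))\<^sup>2 + (cmod (b * fst z + cnj a * snd z))\<^sup>2) =
      of_real (((cmod a)\<^sup>2 + (cmod b)\<^sup>2) * ((cmod (fst z))\<^sup>2 + (cmod (snd z))\<^sup>2))"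
    by (simp add: complex_norm_square del: of_real_power) (simp add: algebra_simps)
  then show ?thesis
    unfolding of_real_eq_iff assms by (simp add: norm_prod_def su2_act_def)
qed

lemma continuous_on_matrix_mult:
  fixes f g :: "'a :: topological_space \<Rightarrow> cmat2"
  assumes "continuous_on S f" "continuous_on S g"
  shows "continuous_on S (\<lambda>x. f x ** g x)"
  unfolding matrix_matrix_mult_def
  by (intro continuous_on_vec_lambda continuous_intros assms)

lemma measurable_su2_translation [measurable]:
  assumes "h \<in> SU2" "h' \<in> SU2"
  shows "(\<lambda>g. h ** g ** h') \<in> su2_measure \<rightarrow>\<^sub>M su2_measure"
proof -
  have "(\<lambda>g. h ** g ** h') \<in> restrict_space borel SU2 \<rightarrow>\<^sub>M restrict_space borel SU2"
    using assms
    by (intro measurable_restrict_space3 borel_measurable_continuous_onI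
        continuous_on_matrix_mult continuous_intros) (auto intro: SU2_mult_closed)
  then show ?thesis
    by (subst measurable_cong_sets[OF sets_su2_measure sets_su2_measure])
qed

lemma distr_su2_left:
  assumes "h \<in> SU2"
  shows "distr su2_measure su2_measure (\<lambda>g. h ** g) = su2_measure"
proof -
  obtain a b where h: "h = su2_mat a b" and ab: "(cmod a)\<^sup>2 + (cmod b)\<^sup>2 = 1"
    using assms by (auto simp: SU2_def)
  have "(\<lambda>g. h ** g ** mat 1) \<in> su2_measure \<rightarrow>\<^sub>M su2_measure"
    using assms by (intro measurable_su2_translation) (simp_all add: mat_1_eq_su2_mat su2_mat_in_SU2)
  then have "(\<lambda>g. h ** g) \<in> su2_measure \<rightarrow>\<^sub>M su2_measure" by simp
  moreover have "h ** su2_proj z = su2_proj (su2_act a b z)" for z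
    by (simp add: su2_proj_def norm_su2_act[OF ab] h su2_mat_mult)
      (simp add: su2_act_def diff_divide_distrib add_divide_distrib)
  ultimately show ?thesis
    by (intro distr_su2_measure[of "su2_act a b"] lborel_su2_act norm_su2_act ab measurable_su2_act)
qed

lemma distr_su2_right:
  assumes "h \<in> SU2"
  shows "distr su2_measure su2_measure (\<lambda>g. g ** h) = su2_measure"
proof -
  obtain a b where h: "h = su2_mat a b" and ab: "(cmod a)\<^sup>2 + (cmod b)\<^sup>2 = 1"
    using assms by (auto simp: SU2_def)
  have "(\<lambda>g. mat 1 ** g ** h) \<in> su2_measure \<rightarrow>\<^sub>M su2_measure"
    using assms by (intro measurable_su2_translation) (simp_all add: mat_1_eq_su2_mat su2_mat_in_SU2)
  then have m: "(\<lambda>g. g ** h) \<in> su2_measure \<rightarrow>\<^sub>M su2_measure" by simp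
  \<comment> \<open>\<open>?k\<close> is its own inverse. On first rows, right multiplication by
    \<open>su2_mat a b\<close> is \<open>su2_act a (- cnj b)\<close>, so \<open>?T\<close> is right
    translation written in first-column coordinates.\<close>
  let ?k = "\<lambda>z :: complex \<times> complex. (fst z, - cnj (snd z))"
  let ?T = "\<lambda>z. ?k (su2_act a (- cnj b) (?k z))"
  have ab': "(cmod a)\<^sup>2 + (cmod (- cnj b))\<^sup>2 = 1" using ab by simp
  have k: "?k \<in> borel_measurable borel"
    by (intro measurable_complex_pair continuous_intros)
  have nk: "norm (?k z) = norm z" for z by (simp add: norm_prod_def)
  have nT: "norm (?T z) = norm z" for z
    by (simp only: nk norm_su2_act[OF ab'])
  have "su2_proj z ** h = su2_proj (?T z)" for z
    unfolding su2_proj_def nT h su2_mat_mult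
    by (simp add: su2_act_def diff_divide_distrib add_divide_distrib mult.commute)
  moreover have "distr lborel borel ?T = lborel"
    using k measurable_compose[OF k measurable_su2_act]
    by (intro lborel_distr_comp[of ?k "\<lambda>z. su2_act a (- cnj b) (?k z)"]
        lborel_distr_comp[of "su2_act a (- cnj b)" ?k] lborel_su2_act[OF ab'] lborel_reflect measurable_su2_act)
  moreover have "?T \<in> borel_measurable borel"
    by (rule measurable_compose[OF measurable_compose[OF k measurable_su2_act] k])
  ultimately show ?thesis
    by (intro distr_su2_measure[of ?T] nT m)
qed

subsection \<open>Sesquilinear forms invariant under the Wigner matrices\<close>

text \<open>Schur's lemma by hand: diagonal matrices of the group kill the off-diagonal entries of \<open>C\<close>,
  and then one group element with nonvanishing entries relates all diagonal entries to the last.\<close>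
lemma invariant_form_const:
  fixes P :: "nat \<Rightarrow> nat \<Rightarrow> cmat2 \<Rightarrow> complex" and C :: "nat \<Rightarrow> nat \<Rightarrow> complex"
  assumes inv: "\<And>k i i'. k \<in> SU2 \<Longrightarrow> i \<le> n \<Longrightarrow> i' \<le> n \<Longrightarrow>
      C i i' = (\<Sum>p\<le>n. \<Sum>q\<le>n. cnj (P i p k) * P i' q k * C p q)"
    and diag: "\<And>u i p. i \<le> n \<Longrightarrow> p \<le> n \<Longrightarrow>
      P i p (su2_mat u 0) = (if i = p then cnj u ^ i * u ^ (n - i) else 0)"
    and k: "k \<in> SU2"
    and inverse: "\<And>t p. t \<le> n \<Longrightarrow> p \<le> n \<Longrightarrow> (\<Sum>i\<le>n. P t i k' * P i p k) = (if t = p then 1 else 0)"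
    and last: "\<And>i. i \<le> n \<Longrightarrow> P n i k' = cnj (P i n k)" "\<And>i. i \<le> n \<Longrightarrow> P i n k \<noteq> 0"
    and i: "i \<le> n"
  shows "C i i = C n n"
proof -
  have off: "C i i' = 0" if i: "i \<le> n" "i' \<le> n" "i \<noteq> i'" for i i'
  proof -
    \<comment> \<open>The diagonal element multiplies \<open>C i i'\<close> by a phase of angle
      \<open>2 * (real i - real i') * \<theta>\<close>. This choice makes the angle
      \<open>pi\<close>, so that \<open>C i i' = - C i i'\<close>.\<close>
    define \<theta> where "\<theta> = pi / (2 * (real i - real i'))"
    let ?u = "cis \<theta>"
    have "C i i' = (\<Sum>p\<le>n. \<Sum>q\<le>n. cnj (P i p (su2_mat ?u 0)) * P i' q (su2_mat ?u 0) * C p q)"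
      using i by (intro inv su2_mat_in_SU2) auto
    also have "\<dots> = (\<Sum>p\<le>n. \<Sum>q\<le>n. if q = i' then (if p = i then
        cnj (P i i (su2_mat ?u 0)) * P i' i' (su2_mat ?u 0) * C i i' else 0) else 0)"
      using i by (intro sum.cong refl) (auto simp: diag)
    also have "\<dots> = cnj (P i i (su2_mat ?u 0)) * P i' i' (su2_mat ?u 0) * C i i'"
      using i by simp
    also have "cnj (P i i (su2_mat ?u 0)) * P i' i' (su2_mat ?u 0) =
        cis (real i * \<theta> + real (n - i) * (- \<theta>) + real i' * (- \<theta>) + real (n - i') * \<theta>)"
      using i(1,2) by (simp only: diag if_True complex_cnj_mult complex_cnj_power complex_cnj_cnj
          cis_cnj Complex.DeMoivre cis_mult simp_thms)
          (simp add: algebra_simps)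
    also have "real i * \<theta> + real (n - i) * (- \<theta>) + real i' * (- \<theta>) + real (n - i') * \<theta> =
        2 * (real i - real i') * \<theta>"
      using i by (simp add: of_nat_diff algebra_simps)
    also have "\<dots> = pi" using i by (simp add: \<theta>_def)
    finally show ?thesis by simp
  qed
  have C: "(if i = i' then C i i else 0) = (\<Sum>p\<le>n. cnj (P i p k) * P i' p k * C p p)"
    if i: "i \<le> n" "i' \<le> n" for i i'
  proof -
    have "(if i = i' then C i i else 0) = C i i'" using off i by auto
    also have "\<dots> = (\<Sum>p\<le>n. \<Sum>q\<le>n. if q = p then cnj (P i p k) * P i' p k * C p p else 0)"
      unfolding inv[OF k i] using off by (intro sum.cong refl) auto
    finally show ?thesis by simp
  qed
  \<comment> \<open>Contracting \<open>i'\<close> with the last row at the inverse \<open>k'\<close>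
    isolates \<open>p = n\<close>. Of the two remaining factors, \<open>last\<close> says that they
    agree and do not vanish, so they cancel.\<close>
  have "P n i k' * C i i = (\<Sum>i'\<le>n. P n i' k' * (if i = i' then C i i else 0))"
    using i by (simp add: if_distrib cong: if_cong)
  also have "\<dots> = (\<Sum>p\<le>n. cnj (P i p k) * C p p * (\<Sum>i'\<le>n. P n i' k' * P i' p k))"
    using i by (simp add: C sum_distrib_left mult_ac) (rule sum.swap)
  also have "\<dots> = (\<Sum>p\<le>n. if p = n then cnj (P i n k) * C n n else 0)"
    by (intro sum.cong refl) (simp add: inverse)
  also have "\<dots> = cnj (P i n k) * C n n" by simp
  finally show ?thesis using last[OF i] by simp
qed

lemma wigner_mat_inverse:
  assumes "g \<in> SU2" "g ** h = mat 1" "k \<le> n" "j \<le> n"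
  shows "(\<Sum>p\<le>n. wigner_mat n k p g * wigner_mat n p j h) = (if k = j then 1 else 0)"
  using wigner_mat_mult[OF assms(1,4,3), of h] assms(3,4)
  by (simp add: assms(2) mat_1_eq_su2_mat wigner_mat_diag split: if_splits)

lemma wigner_form_const_row:
  assumes inv: "\<And>k i i'. k \<in> SU2 \<Longrightarrow> i \<le> n \<Longrightarrow> i' \<le> n \<Longrightarrow>
      C i i' = (\<Sum>p\<le>n. \<Sum>q\<le>n. cnj (wigner_mat n i p k) * wigner_mat n i' q k * C p q)"
    and i: "i \<le> n"
  shows "C i i = C n n"
proof -
  \<comment> \<open>A Pythagorean pair: nonzero entries keep the last column free of zeros, real
    ones make the inverse a mere sign change of the second entry.\<close>
  have s: "(cmod (3 / 5))\<^sup>2 + (cmod (4 / 5))\<^sup>2 = 1" "(cmod (3 / 5))\<^sup>2 + (cmod (- (4 / 5)))\<^sup>2 = 1"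
    by (simp_all add: norm_divide power2_eq_square)
  show ?thesis
  proof (rule invariant_form_const[where P = "wigner_mat n" and k = "su2_mat (3 / 5) (4 / 5)"
        and k' = "su2_mat (3 / 5) (- (4 / 5))", OF inv])
    show "su2_mat (3 / 5) (4 / 5) \<in> SU2" using s(1) by (rule su2_mat_in_SU2)
    show "(\<Sum>i\<le>n. wigner_mat n t i (su2_mat (3 / 5) (- (4 / 5))) * wigner_mat n i p (su2_mat (3 / 5) (4 / 5))) =
        (if t = p then 1 else 0)" if "t \<le> n" "p \<le> n" for t p
      using that su2_mat_inverse(2)[OF s(1)]
      by (intro wigner_mat_inverse su2_mat_in_SU2 s(2)) simp_all
  qed (use i in \<open>auto simp: wigner_mat_diag wigner_mat_last_column wigner_mat_last_row binom_root_nonzero\<close>)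
qed

text \<open>The general form is applied to the transposed matrices. Transposition exchanges last row
  and last column and reverses products, so \<open>k\<close> and its inverse swap places.\<close>

lemma wigner_form_const_column:
  assumes inv: "\<And>k i i'. k \<in> SU2 \<Longrightarrow> i \<le> n \<Longrightarrow> i' \<le> n \<Longrightarrow>
      C i i' = (\<Sum>p\<le>n. \<Sum>q\<le>n. cnj (wigner_mat n p i k) * wigner_mat n q i' k * C p q)"
    and i: "i \<le> n"
  shows "C i i = C n n"
proof -
  have s: "(cmod (3 / 5))\<^sup>2 + (cmod (4 / 5))\<^sup>2 = 1" "(cmod (3 / 5))\<^sup>2 + (cmod (- (4 / 5)))\<^sup>2 = 1"
    by (simp_all add: norm_divide power2_eq_square)
  show ?thesis
  proof (rule invariant_form_const[where P = "\<lambda>i p. wigner_mat n p i" and k = "su2_mat (3 / 5) (- (4 / 5))"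
        and k' = "su2_mat (3 / 5) (4 / 5)", OF inv])
    show "su2_mat (3 / 5) (- (4 / 5)) \<in> SU2" using s(2) by (rule su2_mat_in_SU2)
    show "(\<Sum>i\<le>n. wigner_mat n i t (su2_mat (3 / 5) (4 / 5)) * wigner_mat n p i (su2_mat (3 / 5) (- (4 / 5)))) =
        (if t = p then 1 else 0)" if "t \<le> n" "p \<le> n" for t p
    proof -
      have "(\<Sum>i\<le>n. wigner_mat n p i (su2_mat (3 / 5) (- (4 / 5))) * wigner_mat n i t (su2_mat (3 / 5) (4 / 5))) =
          (if p = t then 1 else 0)"
        using that su2_mat_inverse(2)[OF s(1)]
        by (intro wigner_mat_inverse su2_mat_in_SU2 s(2)) simp_all
      then show ?thesis by (simp add: mult.commute eq_commute)
    qed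
  qed (use i in \<open>auto simp: wigner_mat_diag wigner_mat_last_column wigner_mat_last_row binom_root_nonzero\<close>)
qed


subsection \<open>Fourier coefficients of translates\<close>

interpretation su2: finite_measure su2_measure
  by standard (simp add: emeasure_su2_measure)

text \<open>The test function is arbitrary so that, besides Wigner coefficients, the constant
  function 1 gives plain integrals over the group.\<close>

definition su2_coeff :: "(cmat2 \<Rightarrow> complex) \<Rightarrow> (cmat2 \<Rightarrow> complex) \<Rightarrow> complex" where
  "su2_coeff \<phi> f = (\<integral>g. f g * cnj (\<phi> g) \<partial>su2_measure)"

text \<open>A class that contains the constants and the Wigner functions, is closed under
  conjugation, and pairs with every integrable function.\<close>

definition su2_bounded :: "(cmat2 \<Rightarrow> complex) \<Rightarrow> bool" where
  "su2_bounded \<phi> \<longleftrightarrow> \<phi> \<in> borel_measurable su2_measure \<and> (\<exists>B. \<forall>g\<in>SU2. cmod (\<phi> g) \<le> B)"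

lemma bounded_SU2: "bounded SU2"
  unfolding bounded_iff
proof (intro exI ballI)
  fix g assume "g \<in> SU2"
  then obtain a b where g: "g = su2_mat a b" "(cmod a)\<^sup>2 + (cmod b)\<^sup>2 = 1" by (auto simp: SU2_def)
  then have le: "cmod a \<le> 1" "cmod b \<le> 1"
    using abs_square_le_1[of "cmod a"] abs_square_le_1[of "cmod b"]
    by (smt (verit) abs_norm_cancel zero_le_power2)+
  have "norm g \<le> (\<Sum>i\<in>UNIV. norm (g $ i))"
    unfolding norm_vec_def by (intro L2_set_le_sum) simp
  also have "\<dots> \<le> (\<Sum>i\<in>UNIV. \<Sum>j\<in>UNIV. norm (g $ i $ j))"
    unfolding norm_vec_def[of "g $ _"] by (intro sum_mono L2_set_le_sum) simp
  also have "\<dots> \<le> 4" using le by (simp add: sum_2 g)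
  finally show "norm g \<le> 4" .
qed

text \<open>Continuity on the whole matrix space is used on the closure of the bounded set
  \<open>SU2\<close>, which is compact.\<close>

lemma su2_bounded_continuous:
  assumes "continuous_on UNIV \<phi>"
  shows "su2_bounded \<phi>"
proof -
  have "compact (\<phi> ` closure SU2)"
    using assms bounded_SU2 by (intro compact_continuous_image) (auto intro: continuous_on_subset)
  then have "bounded (\<phi> ` SU2)"
    by (rule bounded_subset[OF compact_imp_bounded]) (simp add: closure_subset image_mono)
  moreover have "\<phi> \<in> borel_measurable su2_measure"
    by (subst measurable_cong_sets[OF sets_su2_measure refl])
      (intro measurable_restrict_space1 borel_measurable_continuous_onI assms)
  ultimately show ?thesis by (auto simp: su2_bounded_def bounded_iff)
qed

lemma borel_measurable_cnj [measurable (raw)]: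
  "f \<in> borel_measurable N \<Longrightarrow> (\<lambda>x. cnj (f x)) \<in> borel_measurable N"
  by (rule measurable_compose[where g = cnj])
    (auto intro!: borel_measurable_continuous_onI continuous_intros)

lemma integrable_mult_bounded:
  fixes f \<kappa> :: "'a \<Rightarrow> complex"
  assumes "integrable N f" "\<kappa> \<in> borel_measurable N" "\<And>x. x \<in> space N \<Longrightarrow> cmod (\<kappa> x) \<le> B"
  shows "integrable N (\<lambda>x. f x * \<kappa> x)"
proof (rule Bochner_Integration.integrable_bound)
  show "integrable N (\<lambda>x. of_real B * f x)" using assms(1) by simp
  show "AE x in N. norm (f x * \<kappa> x) \<le> norm (of_real B * f x)"
  proof (rule AE_I2)
    fix x assume x: "x \<in> space N"
    have "cmod (\<kappa> x) \<le> \<bar>B\<bar>" using assms(3)[OF x] by linarith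
    then show "norm (f x * \<kappa> x) \<le> norm (of_real B * f x)"
      by (simp add: norm_mult mult.commute[of "cmod (f x)"] mult_right_mono)
  qed
qed (use assms in measurable)

lemma integrable_su2_coeff:
  assumes "su2_bounded \<phi>" "integrable su2_measure f"
  shows "integrable su2_measure (\<lambda>g. f g * cnj (\<phi> g))"
proof -
  obtain B where "\<phi> \<in> borel_measurable su2_measure" "\<forall>g\<in>SU2. cmod (\<phi> g) \<le> B"
    using assms(1) by (auto simp: su2_bounded_def)
  then show ?thesis
    using assms(2) by (intro integrable_mult_bounded[where B = B] borel_measurable_cnj) auto
qed

lemma integral_su2_left:
  fixes F :: "cmat2 \<Rightarrow> 'b :: {banach, second_countable_topology}"
  assumes "h \<in> SU2" "F \<in> borel_measurable su2_measure"
  shows "(\<integral>g. F (h ** g) \<partial>su2_measure) = (\<integral>g. F g \<partial>su2_measure)"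
proof -
  have m: "(\<lambda>g. h ** g) \<in> su2_measure \<rightarrow>\<^sub>M su2_measure"
    using measurable_su2_translation[OF assms(1), of "mat 1"]
    by (simp add: mat_1_eq_su2_mat[symmetric] su2_mat_in_SU2[of 1 0, folded mat_1_eq_su2_mat])
  show ?thesis
    using integral_distr[OF m, of F] assms by (simp add: distr_su2_left)
qed

lemma integral_su2_right:
  fixes F :: "cmat2 \<Rightarrow> 'b :: {banach, second_countable_topology}"
  assumes "h \<in> SU2" "F \<in> borel_measurable su2_measure"
  shows "(\<integral>g. F (g ** h) \<partial>su2_measure) = (\<integral>g. F g \<partial>su2_measure)"
proof -
  have m: "(\<lambda>g. g ** h) \<in> su2_measure \<rightarrow>\<^sub>M su2_measure"
    using measurable_su2_translation[OF _ assms(1), of "mat 1"]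
    by (simp add: mat_1_eq_su2_mat[symmetric] su2_mat_in_SU2[of 1 0, folded mat_1_eq_su2_mat])
  show ?thesis
    using integral_distr[OF m, of F] assms by (simp add: distr_su2_right)
qed

definition phi_mat :: "nat \<Rightarrow> nat \<Rightarrow> nat \<Rightarrow> cmat2 \<Rightarrow> complex" where
  "phi_mat n k j = wigner_phi (real n / 2) (real k - real n / 2) (real j - real n / 2)"

lemma phi_mat_eq: "phi_mat n k j g = of_real (sqrt (real n + 1) / (4 * pi)) * wigner_mat n k j g"
  by (simp add: phi_mat_def wigner_phi_def wigner_mat_def)

lemma su2_bounded_phi_mat:
  assumes "k \<le> n" "j \<le> n"
  shows "su2_bounded (phi_mat n k j)"
  unfolding phi_mat_eq[abs_def]
  by (intro su2_bounded_continuous continuous_intros continuous_on_wigner_mat assms)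

text \<open>Writing \<open>g = k ** (h ** g)\<close> in the basis function and expanding by
  \<open>wigner_mat_mult\<close> makes the integrand a function of \<open>h ** g\<close> alone,
  after which left invariance of the volume removes \<open>h\<close>.\<close>

lemma su2_coeff_left:
  assumes h: "h \<in> SU2" and k: "k \<in> SU2" "k ** h = mat 1"
    and f: "integrable su2_measure f" and ij: "i \<le> n" "j \<le> n"
  shows "su2_coeff (phi_mat n i j) (\<lambda>g. f (h ** g)) =
    (\<Sum>p\<le>n. cnj (wigner_mat n i p k) * su2_coeff (phi_mat n p j) f)"
proof -
  let ?F = "\<lambda>g. \<Sum>p\<le>n. cnj (wigner_mat n i p k) * (f g * cnj (phi_mat n p j g))"
  have int: "integrable su2_measure (\<lambda>g. f g * cnj (phi_mat n p j g))" if "p \<le> n" for p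
    using that ij f by (intro integrable_su2_coeff su2_bounded_phi_mat)
  have "f (h ** g) * cnj (phi_mat n i j g) = ?F (h ** g)" for g
  proof -
    have "phi_mat n i j g = phi_mat n i j (k ** (h ** g))"
      by (simp add: matrix_mul_assoc k(2))
    also have "\<dots> = (\<Sum>p\<le>n. wigner_mat n i p k * phi_mat n p j (h ** g))"
      unfolding phi_mat_eq wigner_mat_mult[OF k(1) ij(2,1)] by (simp add: sum_distrib_left mult_ac)
    finally show ?thesis by (simp add: sum_distrib_left mult_ac)
  qed
  then have "su2_coeff (phi_mat n i j) (\<lambda>g. f (h ** g)) = (\<integral>g. ?F (h ** g) \<partial>su2_measure)"
    by (simp add: su2_coeff_def)
  also have "\<dots> = (\<integral>g. ?F g \<partial>su2_measure)"
    using int by (intro integral_su2_left h borel_measurable_sum borel_measurable_times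
        borel_measurable_const borel_measurable_integrable) auto
  also have "\<dots> = (\<Sum>p\<le>n. cnj (wigner_mat n i p k) * su2_coeff (phi_mat n p j) f)"
    unfolding su2_coeff_def using int
    by (subst Bochner_Integration.integral_sum) (auto intro!: sum.cong integral_mult_right_zero)
  finally show ?thesis .
qed

lemma su2_coeff_right:
  assumes h: "h \<in> SU2" and k: "h ** k = mat 1"
    and f: "integrable su2_measure f" and ij: "i \<le> n" "j \<le> n"
  shows "su2_coeff (phi_mat n i j) (\<lambda>g. f (g ** h)) =
    (\<Sum>p\<le>n. cnj (wigner_mat n p j k) * su2_coeff (phi_mat n i p) f)"
proof -
  let ?F = "\<lambda>g. \<Sum>p\<le>n. cnj (wigner_mat n p j k) * (f g * cnj (phi_mat n i p g))"
  have int: "integrable su2_measure (\<lambda>g. f g * cnj (phi_mat n i p g))" if "p \<le> n" for p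
    using that ij f by (intro integrable_su2_coeff su2_bounded_phi_mat)
  \<comment> \<open>\<open>wigner_mat_mult\<close> asks its first factor, here
    \<open>g ** h\<close>, to lie in the group, so this identity is only available on the space of
    the measure.\<close>
  have "f (g ** h) * cnj (phi_mat n i j g) = ?F (g ** h)" if g: "g \<in> SU2" for g
  proof -
    have "phi_mat n i j g = phi_mat n i j ((g ** h) ** k)"
      by (simp add: k flip: matrix_mul_assoc)
    also have "\<dots> = (\<Sum>p\<le>n. wigner_mat n p j k * phi_mat n i p (g ** h))"
      unfolding phi_mat_eq wigner_mat_mult[OF SU2_mult_closed[OF g h] ij(2,1)]
      by (simp add: sum_distrib_left mult_ac)
    finally show ?thesis by (simp add: sum_distrib_left mult_ac)
  qed
  then have "su2_coeff (phi_mat n i j) (\<lambda>g. f (g ** h)) = (\<integral>g. ?F (g ** h) \<partial>su2_measure)"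
    unfolding su2_coeff_def by (intro Bochner_Integration.integral_cong) simp_all
  also have "\<dots> = (\<integral>g. ?F g \<partial>su2_measure)"
    using int by (intro integral_su2_right h borel_measurable_sum borel_measurable_times
        borel_measurable_const borel_measurable_integrable) auto
  also have "\<dots> = (\<Sum>p\<le>n. cnj (wigner_mat n p j k) * su2_coeff (phi_mat n i p) f)"
    unfolding su2_coeff_def using int
    by (subst Bochner_Integration.integral_sum) (auto intro!: sum.cong integral_mult_right_zero)
  finally show ?thesis .
qed

subsection \<open>Energy and truncation\<close>

definition su2_energy :: "(cmat2 \<Rightarrow> complex) \<Rightarrow> real" where
  "su2_energy f = (\<integral>g. (cmod (f g))\<^sup>2 \<partial>su2_measure)"

lemma su2_energy_nonneg: "0 \<le> su2_energy f"
  by (simp add: su2_energy_def)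

lemma su2_norm_square: "(su2_norm f)\<^sup>2 = su2_energy f"
  by (simp add: su2_norm_def su2_energy_def)

lemma measure_su2: "measure su2_measure SU2 = 16 * pi\<^sup>2"
  by (simp add: measure_def emeasure_su2_measure)

lemma su2_square_integrable_norm:
  assumes "su2_square_integrable f"
  shows "integrable su2_measure (\<lambda>g. cmod (f g))"
proof (rule Bochner_Integration.integrable_bound)
  show "integrable su2_measure (\<lambda>g. 1 + (cmod (f g))\<^sup>2)"
    using assms by (simp add: su2_square_integrable_def)
  show "(\<lambda>g. cmod (f g)) \<in> borel_measurable su2_measure"
  proof -
    have [measurable]: "f \<in> borel_measurable su2_measure"
      using assms by (simp add: su2_square_integrable_def)
    show ?thesis by measurable
  qed
  have "x \<le> 1 + x\<^sup>2" for x :: real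
  proof -
    have "2 * x \<le> 1 + x\<^sup>2" using zero_le_power2[of "x - 1"] by (simp add: power2_diff)
    moreover have "0 \<le> x\<^sup>2" by simp
    ultimately show ?thesis by linarith
  qed
  then show "AE g in su2_measure. norm (cmod (f g)) \<le> norm (1 + (cmod (f g))\<^sup>2)"
    by simp
qed

lemma su2_square_integrable_integrable:
  "su2_square_integrable f \<Longrightarrow> integrable su2_measure f"
  using su2_square_integrable_norm[of f] by (simp add: su2_square_integrable_def integrable_norm_iff)

text \<open>Cauchy-Schwarz on a space of total mass \<open>16 * pi\<^sup>2\<close>. It keeps
  coefficient products divided by the energy uniformly bounded, which is the domination behind every
  later limit.\<close>

lemma su2_coeff_bound:
  assumes f: "su2_square_integrable f"
    and \<phi>: "\<phi> \<in> borel_measurable su2_measure" "\<And>g. g \<in> SU2 \<Longrightarrow> cmod (\<phi> g) \<le> B"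
  shows "(cmod (su2_coeff \<phi> f))\<^sup>2 \<le> B\<^sup>2 * (16 * pi\<^sup>2) * su2_energy f"
proof -
  let ?V = "16 * pi\<^sup>2" and ?I = "\<integral>g. cmod (f g) \<partial>su2_measure"
  have i1: "integrable su2_measure (\<lambda>g. cmod (f g))" using f by (rule su2_square_integrable_norm)
  have i2: "integrable su2_measure (\<lambda>g. (cmod (f g))\<^sup>2)" using f by (simp add: su2_square_integrable_def)
  \<comment> \<open>Cauchy-Schwarz against the constant 1, obtained from the nonnegativity of the
    variance of \<open>cmod (f g)\<close>.\<close>
  have "0 \<le> (\<integral>g. (cmod (f g) - ?I / ?V)\<^sup>2 \<partial>su2_measure)"
    by (intro integral_nonneg_AE) simp
  also have "\<dots> = (\<integral>g. (cmod (f g))\<^sup>2 + ((?I / ?V)\<^sup>2 - 2 * (?I / ?V) * cmod (f g)) \<partial>su2_measure)"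
    by (simp add: power2_diff algebra_simps)
  also have "\<dots> = su2_energy f + ((?I / ?V)\<^sup>2 * ?V - 2 * (?I / ?V) * ?I)"
    using i1 i2 by (simp add: su2_energy_def measure_su2)
  also have "\<dots> = su2_energy f - ?I\<^sup>2 / ?V"
    by (simp add: power2_eq_square field_simps)
  finally have le: "?I\<^sup>2 \<le> ?V * su2_energy f" by (simp add: field_simps)
  have "cmod (su2_coeff \<phi> f) \<le> (\<integral>g. cmod (f g) * \<bar>B\<bar> \<partial>su2_measure)"
    unfolding su2_coeff_def
  proof (rule Bochner_Integration.integral_norm_bound_integral)
    show "integrable su2_measure (\<lambda>g. f g * cnj (\<phi> g))"
      using f \<phi> by (intro integrable_su2_coeff su2_square_integrable_integrable)
        (auto simp: su2_bounded_def)
    show "integrable su2_measure (\<lambda>g. cmod (f g) * \<bar>B\<bar>)" using i1 by simp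
    fix g assume "g \<in> space su2_measure"
    then have "cmod (\<phi> g) \<le> \<bar>B\<bar>" using \<phi>(2)[of g] by simp
    then show "norm (f g * cnj (\<phi> g)) \<le> cmod (f g) * \<bar>B\<bar>"
      by (simp add: norm_mult mult_left_mono)
  qed
  then have "(cmod (su2_coeff \<phi> f))\<^sup>2 \<le> (?I * \<bar>B\<bar>)\<^sup>2"
    by (intro power_mono) simp_all
  also have "\<dots> \<le> B\<^sup>2 * (?V * su2_energy f)"
    using le by (simp add: power_mult_distrib mult.commute mult_left_mono)
  finally show ?thesis by (simp add: mult_ac)
qed

text \<open>Cutting to 0 keeps the result a bounded Borel function of the single value
  \<open>z\<close>, never larger in modulus than \<open>z\<close> and eventually equal to it, as the
  dominated limits require.\<close>

definition trunc :: "nat \<Rightarrow> complex \<Rightarrow> complex" where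
  "trunc n z = (if cmod z \<le> real n then z else 0)"

lemma measurable_trunc [measurable]: "trunc n \<in> borel_measurable borel"
  unfolding trunc_def[abs_def] by measurable

lemma norm_trunc_le: "cmod (trunc n z) \<le> real n" "cmod (trunc n z) \<le> cmod z"
  by (simp_all add: trunc_def)

lemma trunc_tendsto: "(\<lambda>n. trunc n z) \<longlonglongrightarrow> z"
proof (rule tendsto_eventually)
  obtain N where "cmod z \<le> real N" using real_arch_simple by blast
  then show "\<forall>\<^sub>F n in sequentially. trunc n z = z"
    by (intro eventually_sequentiallyI[of N]) (simp add: trunc_def)
qed

lemma su2_square_integrable_trunc:
  assumes "f \<in> borel_measurable su2_measure"
  shows "su2_square_integrable (\<lambda>g. trunc n (f g))"
  unfolding su2_square_integrable_def
proof
  show m: "(\<lambda>g. trunc n (f g)) \<in> borel_measurable su2_measure"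
    using assms measurable_trunc by (rule measurable_compose)
  then show "integrable su2_measure (\<lambda>g. (cmod (trunc n (f g)))\<^sup>2)"
    by (intro su2.integrable_const_bound[where B = "(real n)\<^sup>2"])
      (auto intro!: power_mono norm_trunc_le)
qed

lemma su2_energy_trunc_tendsto:
  assumes "su2_square_integrable f"
  shows "(\<lambda>n. su2_energy (\<lambda>g. trunc n (f g))) \<longlonglongrightarrow> su2_energy f"
  unfolding su2_energy_def
proof (rule integral_dominated_convergence)
  show "integrable su2_measure (\<lambda>g. (cmod (f g))\<^sup>2)"
    using assms by (simp add: su2_square_integrable_def)
  then show "(\<lambda>g. (cmod (f g))\<^sup>2) \<in> borel_measurable su2_measure" by simp
  show "(\<lambda>g. (cmod (trunc n (f g)))\<^sup>2) \<in> borel_measurable su2_measure" for n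
    using su2_square_integrable_trunc[of f n] assms by (simp add: su2_square_integrable_def)
  show "AE g in su2_measure. (\<lambda>n. (cmod (trunc n (f g)))\<^sup>2) \<longlonglongrightarrow> (cmod (f g))\<^sup>2"
    by (intro AE_I2 tendsto_intros trunc_tendsto)
  show "AE g in su2_measure. norm ((cmod (trunc n (f g)))\<^sup>2) \<le> (cmod (f g))\<^sup>2" for n
    by (auto intro!: power_mono norm_trunc_le)
qed

lemma su2_coeff_trunc_tendsto:
  assumes f: "su2_square_integrable f" and \<phi>: "su2_bounded \<phi>"
  shows "(\<lambda>n. su2_coeff \<phi> (\<lambda>g. trunc n (f g))) \<longlonglongrightarrow> su2_coeff \<phi> f"
  unfolding su2_coeff_def
proof (rule integral_dominated_convergence)
  have int: "integrable su2_measure (\<lambda>g. f g * cnj (\<phi> g))"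
    using f \<phi> by (intro integrable_su2_coeff su2_square_integrable_integrable)
  then show "integrable su2_measure (\<lambda>g. cmod (f g * cnj (\<phi> g)))" by simp
  show "(\<lambda>g. f g * cnj (\<phi> g)) \<in> borel_measurable su2_measure" using int by simp
  have [measurable]: "\<phi> \<in> borel_measurable su2_measure" "f \<in> borel_measurable su2_measure"
    using f \<phi> by (simp_all add: su2_bounded_def su2_square_integrable_def)
  show "(\<lambda>g. trunc n (f g) * cnj (\<phi> g)) \<in> borel_measurable su2_measure" for n
    by measurable
  show "AE g in su2_measure. (\<lambda>n. trunc n (f g) * cnj (\<phi> g)) \<longlonglongrightarrow> f g * cnj (\<phi> g)"
    by (intro AE_I2 tendsto_intros trunc_tendsto)
  show "AE g in su2_measure. norm (trunc n (f g) * cnj (\<phi> g)) \<le> cmod (f g * cnj (\<phi> g))" for n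
    by (intro AE_I2) (simp add: norm_mult mult_right_mono norm_trunc_le)
qed


subsection \<open>Functionals determined by the law of a field\<close>

lemma random_field_section:
  assumes "random_field M X" "\<omega> \<in> space M"
  shows "X \<omega> \<in> borel_measurable su2_measure"
  using measurable_Pair2[of "case_prod X" M su2_measure borel \<omega>] assms by (simp add: random_field_def)

lemma random_field_component:
  assumes "random_field M X" "g \<in> SU2"
  shows "(\<lambda>\<omega>. X \<omega> g) \<in> borel_measurable M"
  using measurable_Pair1[of "case_prod X" M su2_measure borel g] assms by (simp add: random_field_def)

lemma random_field_restrict:
  assumes "random_field M X"
  shows "(\<lambda>\<omega>. restrict (X \<omega>) SU2) \<in> M \<rightarrow>\<^sub>M Pi\<^sub>M SU2 (\<lambda>_. borel)"
  by (intro measurable_restrict random_field_component assms)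

text \<open>Rests on joint measurability: the integrand is measurable in the pair of sample point
  and group element, so integrating out the latter leaves a random variable.\<close>

lemma random_field_integral:
  fixes F :: "cmat2 \<Rightarrow> complex \<Rightarrow> 'b :: {banach, second_countable_topology}"
  assumes "random_field M X" "(\<lambda>(g, z). F g z) \<in> borel_measurable (su2_measure \<Otimes>\<^sub>M borel)"
  shows "(\<lambda>\<omega>. \<integral>g. F g (X \<omega> g) \<partial>su2_measure) \<in> borel_measurable M"
proof -
  have [measurable]: "case_prod X \<in> borel_measurable (M \<Otimes>\<^sub>M su2_measure)"
    using assms(1) by (simp add: random_field_def)
  have "(\<lambda>p. (snd p, case_prod X p)) \<in> M \<Otimes>\<^sub>M su2_measure \<rightarrow>\<^sub>M su2_measure \<Otimes>\<^sub>M borel"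
    by (intro measurable_Pair measurable_snd) measurable
  from measurable_compose[OF this assms(2)]
  have "(\<lambda>(\<omega>, g). F g (X \<omega> g)) \<in> borel_measurable (M \<Otimes>\<^sub>M su2_measure)"
    by (simp add: split_beta)
  then show ?thesis by (rule su2.borel_measurable_lebesgue_integral)
qed

lemma random_field_su2_coeff:
  assumes "random_field M X" "\<phi> \<in> borel_measurable su2_measure" "H \<in> borel_measurable borel"
  shows "(\<lambda>\<omega>. su2_coeff \<phi> (\<lambda>g. H (X \<omega> g))) \<in> borel_measurable M"
  unfolding su2_coeff_def
  by (rule random_field_integral[OF assms(1), of "\<lambda>g z. H z * cnj (\<phi> g)"]) (use assms in measurable)

lemma random_field_su2_energy:
  assumes "random_field M X" "H \<in> borel_measurable borel"
  shows "(\<lambda>\<omega>. su2_energy (\<lambda>g. H (X \<omega> g))) \<in> borel_measurable M"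
  unfolding su2_energy_def
  by (rule random_field_integral[OF assms(1), of "\<lambda>g z. (cmod (H z))\<^sup>2"]) (use assms in measurable)

text \<open>\<open>U\<close> and \<open>V\<close> stand for the same functional of \<open>X\<close> and of \<open>Y\<close>; testing against all bounded
  cylinder functionals \<open>F\<close> makes the relation stable under multiplication by integrals over the group.\<close>
definition equal_in_law ::
    "'w measure \<Rightarrow> ('w \<Rightarrow> cmat2 \<Rightarrow> complex) \<Rightarrow> ('w \<Rightarrow> cmat2 \<Rightarrow> complex) \<Rightarrow>
     ('w \<Rightarrow> complex) \<Rightarrow> ('w \<Rightarrow> complex) \<Rightarrow> bool" where
  "equal_in_law M X Y U V \<longleftrightarrow>
     U \<in> borel_measurable M \<and> V \<in> borel_measurable M \<and>
     (\<exists>B. \<forall>\<omega>\<in>space M. cmod (U \<omega>) \<le> B \<and> cmod (V \<omega>) \<le> B) \<and>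
     (\<forall>F B. F \<in> borel_measurable (Pi\<^sub>M SU2 (\<lambda>_. borel)) \<longrightarrow> (\<forall>x. cmod (F x) \<le> B) \<longrightarrow>
        (\<integral>\<omega>. F (restrict (X \<omega>) SU2) * U \<omega> \<partial>M) = (\<integral>\<omega>. F (restrict (Y \<omega>) SU2) * V \<omega> \<partial>M))"

text \<open>The start of the induction over factors: with trivial \<open>U\<close> and
  \<open>V\<close> the relation is equality of the two laws, tested on bounded functionals.\<close>

lemma equal_in_law_one:
  assumes "random_field M X" "random_field M Y" "field_law M X = field_law M Y"
  shows "equal_in_law M X Y (\<lambda>_. 1) (\<lambda>_. 1)"
proof -
  have "(\<integral>\<omega>. F (restrict (X \<omega>) SU2) \<partial>M) = (\<integral>\<omega>. F (restrict (Y \<omega>) SU2) \<partial>M)"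
    if F: "F \<in> borel_measurable (Pi\<^sub>M SU2 (\<lambda>_. borel))" for F :: "_ \<Rightarrow> complex"
  proof -
    have "(\<integral>x. F x \<partial>field_law M Z) = (\<integral>\<omega>. F (restrict (Z \<omega>) SU2) \<partial>M)" if "random_field M Z" for Z
      unfolding field_law_def by (rule integral_distr[OF random_field_restrict[OF that] F])
    from this[OF assms(1)] this[OF assms(2)] show ?thesis using assms(3) by simp
  qed
  then show ?thesis by (auto simp: equal_in_law_def intro!: exI[of _ 1])
qed

lemma su2_coeff_le_bound:
  assumes "\<And>g. g \<in> SU2 \<Longrightarrow> cmod (\<kappa> g) \<le> B" "\<And>g. g \<in> SU2 \<Longrightarrow> cmod (f g) \<le> K"
    "\<kappa> \<in> borel_measurable su2_measure" "f \<in> borel_measurable su2_measure"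
  shows "cmod (su2_coeff \<kappa> f) \<le> \<bar>K\<bar> * \<bar>B\<bar> * (16 * pi\<^sup>2)"
proof -
  have b: "cmod (f g * cnj (\<kappa> g)) \<le> \<bar>K\<bar> * \<bar>B\<bar>" if "g \<in> SU2" for g
    using assms(1,2)[OF that] by (auto simp: norm_mult intro!: mult_mono)
  have "cmod (su2_coeff \<kappa> f) \<le> (\<integral>g. \<bar>K\<bar> * \<bar>B\<bar> \<partial>su2_measure)"
    unfolding su2_coeff_def using b assms(3,4)
    by (intro Bochner_Integration.integral_norm_bound_integral su2.integrable_const_bound[where B = "\<bar>K\<bar> * \<bar>B\<bar>"]) auto
  then show ?thesis by (simp add: measure_su2 mult_ac)
qed

text \<open>All factors are bounded and both measures finite, so Fubini applies. Afterwards the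
  field enters the expectation next to \<open>W\<close> only through its value at one point
  \<open>g\<close>.\<close>

lemma integral_mult_su2_coeff:
  assumes M: "finite_measure M" and X: "random_field M X"
    and W: "W \<in> borel_measurable M" "\<And>\<omega>. \<omega> \<in> space M \<Longrightarrow> cmod (W \<omega>) \<le> C"
    and \<kappa>: "su2_bounded \<kappa>" and H: "H \<in> borel_measurable borel" "\<And>z. cmod (H z) \<le> K"
  shows "(\<integral>\<omega>. W \<omega> * su2_coeff \<kappa> (\<lambda>g. H (X \<omega> g)) \<partial>M) =
    (\<integral>g. (\<integral>\<omega>. H (X \<omega> g) * W \<omega> \<partial>M) * cnj (\<kappa> g) \<partial>su2_measure)"
proof -
  interpret M: finite_measure M by fact
  interpret P: pair_sigma_finite M su2_measure ..
  interpret MP: finite_measure "M \<Otimes>\<^sub>M su2_measure"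
    by (rule finite_measure_pair_measure) unfold_locales
  obtain B where \<kappa>': "\<kappa> \<in> borel_measurable su2_measure" "\<And>g. g \<in> SU2 \<Longrightarrow> cmod (\<kappa> g) \<le> B"
    using \<kappa> by (auto simp: su2_bounded_def)
  have [measurable]: "case_prod X \<in> borel_measurable (M \<Otimes>\<^sub>M su2_measure)"
    using X by (simp add: random_field_def)
  note [measurable] = \<kappa>'(1) W(1) H(1)
  let ?f = "\<lambda>\<omega> g. W \<omega> * (H (X \<omega> g) * cnj (\<kappa> g))"
  have "case_prod ?f = (\<lambda>p. W (fst p) * (H (case_prod X p) * cnj (\<kappa> (snd p))))"
    by auto
  also have "\<dots> \<in> borel_measurable (M \<Otimes>\<^sub>M su2_measure)" by measurable
  finally have "integrable (M \<Otimes>\<^sub>M su2_measure) (case_prod ?f)"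
  proof (intro MP.integrable_const_bound[where B = "\<bar>C\<bar> * (\<bar>K\<bar> * \<bar>B\<bar>)"] AE_I2)
    fix p assume "p \<in> space (M \<Otimes>\<^sub>M su2_measure)"
    then obtain \<omega> g where p: "p = (\<omega>, g)" "\<omega> \<in> space M" "g \<in> SU2" by (auto simp: space_pair_measure)
    show "norm (case_prod ?f p) \<le> \<bar>C\<bar> * (\<bar>K\<bar> * \<bar>B\<bar>)"
      using W(2)[OF p(2)] H(2)[of "X \<omega> g"] \<kappa>'(2)[OF p(3)]
      by (auto simp: p norm_mult intro!: mult_mono)
  qed
  from P.Fubini_integral[OF this]
  have "(\<integral>\<omega>. (\<integral>g. ?f \<omega> g \<partial>su2_measure) \<partial>M) = (\<integral>g. (\<integral>\<omega>. ?f \<omega> g \<partial>M) \<partial>su2_measure)" ..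
  also have "(\<integral>g. (\<integral>\<omega>. ?f \<omega> g \<partial>M) \<partial>su2_measure) =
      (\<integral>g. (\<integral>\<omega>. H (X \<omega> g) * W \<omega> \<partial>M) * cnj (\<kappa> g) \<partial>su2_measure)"
  proof (rule Bochner_Integration.integral_cong[OF refl])
    fix g
    have "(\<integral>\<omega>. ?f \<omega> g \<partial>M) = (\<integral>\<omega>. (H (X \<omega> g) * W \<omega>) * cnj (\<kappa> g) \<partial>M)"
      by (simp add: mult_ac)
    then show "(\<integral>\<omega>. ?f \<omega> g \<partial>M) = (\<integral>\<omega>. H (X \<omega> g) * W \<omega> \<partial>M) * cnj (\<kappa> g)"
      by (simp only: integral_mult_left_zero)
  qed
  finally show ?thesis by (simp add: su2_coeff_def)
qed

text \<open>Fubini pulls the group integral out of the expectation. For each fixed \<open>g\<close>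
  the factor \<open>H (X \<omega> g)\<close> depends on one coordinate of the path and is absorbed
  into the test functional, where the relation for \<open>U\<close> and \<open>V\<close>
  applies.\<close>

lemma equal_in_law_mult_coeff:
  assumes M: "finite_measure M" and X: "random_field M X" and Y: "random_field M Y"
    and UV: "equal_in_law M X Y U V"
    and \<kappa>: "su2_bounded \<kappa>" and H: "H \<in> borel_measurable borel" "\<And>z. cmod (H z) \<le> K"
  shows "equal_in_law M X Y (\<lambda>\<omega>. U \<omega> * su2_coeff \<kappa> (\<lambda>g. H (X \<omega> g)))
    (\<lambda>\<omega>. V \<omega> * su2_coeff \<kappa> (\<lambda>g. H (Y \<omega> g)))"
proof -
  obtain B where \<kappa>': "\<kappa> \<in> borel_measurable su2_measure" "\<And>g. g \<in> SU2 \<Longrightarrow> cmod (\<kappa> g) \<le> B"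
    using \<kappa> by (auto simp: su2_bounded_def)
  from UV obtain C where U: "U \<in> borel_measurable M" "\<And>\<omega>. \<omega> \<in> space M \<Longrightarrow> cmod (U \<omega>) \<le> C"
    and V: "V \<in> borel_measurable M" "\<And>\<omega>. \<omega> \<in> space M \<Longrightarrow> cmod (V \<omega>) \<le> C"
    by (auto simp: equal_in_law_def)
  have bound: "cmod (W \<omega> * su2_coeff \<kappa> (\<lambda>g. H (Z \<omega> g))) \<le> \<bar>C\<bar> * (\<bar>K\<bar> * \<bar>B\<bar> * (16 * pi\<^sup>2))"
    if Z: "random_field M Z" and W: "\<And>\<omega>. \<omega> \<in> space M \<Longrightarrow> cmod (W \<omega>) \<le> C" and \<omega>: "\<omega> \<in> space M" for W Z \<omega>
  proof -
    have "cmod (su2_coeff \<kappa> (\<lambda>g. H (Z \<omega> g))) \<le> \<bar>K\<bar> * \<bar>B\<bar> * (16 * pi\<^sup>2)"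
      using \<kappa>' H measurable_compose[OF random_field_section[OF Z \<omega>] H(1)]
      by (intro su2_coeff_le_bound) auto
    moreover have "cmod (W \<omega>) \<le> \<bar>C\<bar>" using W[OF \<omega>] by simp
    ultimately show ?thesis by (simp add: norm_mult mult_mono)
  qed
  have eq: "(\<integral>\<omega>. F (restrict (X \<omega>) SU2) * (U \<omega> * su2_coeff \<kappa> (\<lambda>g. H (X \<omega> g))) \<partial>M) =
      (\<integral>\<omega>. F (restrict (Y \<omega>) SU2) * (V \<omega> * su2_coeff \<kappa> (\<lambda>g. H (Y \<omega> g))) \<partial>M)"
    if F: "F \<in> borel_measurable (Pi\<^sub>M SU2 (\<lambda>_. borel))" "\<forall>x. cmod (F x) \<le> D" for F D
  proof -
    have swap: "(\<integral>\<omega>. F (restrict (Z \<omega>) SU2) * (W \<omega> * su2_coeff \<kappa> (\<lambda>g. H (Z \<omega> g))) \<partial>M) =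
        (\<integral>g. (\<integral>\<omega>. (H (restrict (Z \<omega>) SU2 g) * F (restrict (Z \<omega>) SU2)) * W \<omega> \<partial>M) * cnj (\<kappa> g) \<partial>su2_measure)"
      if Z: "random_field M Z" and W: "W \<in> borel_measurable M" "\<And>\<omega>. \<omega> \<in> space M \<Longrightarrow> cmod (W \<omega>) \<le> C" for W Z
    proof -
      have "(\<lambda>\<omega>. F (restrict (Z \<omega>) SU2)) \<in> borel_measurable M"
        by (rule measurable_compose[OF random_field_restrict[OF Z] F(1)])
      moreover have "cmod (F (restrict (Z \<omega>) SU2) * W \<omega>) \<le> \<bar>D\<bar> * \<bar>C\<bar>" if "\<omega> \<in> space M" for \<omega>
        using F(2)[rule_format, of "restrict (Z \<omega>) SU2"] W(2)[OF that]
        by (auto simp: norm_mult intro!: mult_mono)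
      ultimately have "(\<integral>\<omega>. (F (restrict (Z \<omega>) SU2) * W \<omega>) * su2_coeff \<kappa> (\<lambda>g. H (Z \<omega> g)) \<partial>M) =
          (\<integral>g. (\<integral>\<omega>. H (Z \<omega> g) * (F (restrict (Z \<omega>) SU2) * W \<omega>) \<partial>M) * cnj (\<kappa> g) \<partial>su2_measure)"
        using W by (intro integral_mult_su2_coeff[OF M Z _ _ \<kappa> H]) auto
      also have "\<dots> = (\<integral>g. (\<integral>\<omega>. (H (restrict (Z \<omega>) SU2 g) * F (restrict (Z \<omega>) SU2)) * W \<omega> \<partial>M) *
          cnj (\<kappa> g) \<partial>su2_measure)"
        by (rule Bochner_Integration.integral_cong) (simp_all add: mult.assoc)
      finally show ?thesis by (simp only: mult.assoc)
    qed
    have "(\<integral>\<omega>. (H (restrict (X \<omega>) SU2 g) * F (restrict (X \<omega>) SU2)) * U \<omega> \<partial>M) =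
        (\<integral>\<omega>. (H (restrict (Y \<omega>) SU2 g) * F (restrict (Y \<omega>) SU2)) * V \<omega> \<partial>M)" if g: "g \<in> SU2" for g
    proof -
      have "(\<lambda>x. H (x g)) \<in> borel_measurable (Pi\<^sub>M SU2 (\<lambda>_. borel))"
        by (rule measurable_compose[OF measurable_component_singleton[OF g] H(1)])
      \<comment> \<open>The enlarged functional is again measurable for the product sigma-algebra
        and bounded, hence admissible as a test.\<close>
      then have "(\<lambda>x. H (x g) * F x) \<in> borel_measurable (Pi\<^sub>M SU2 (\<lambda>_. borel))"
        using F(1) by measurable
      moreover have "\<forall>x. cmod (H (x g) * F x) \<le> \<bar>K\<bar> * \<bar>D\<bar>"
      proof
        fix x :: "cmat2 \<Rightarrow> complex"
        show "cmod (H (x g) * F x) \<le> \<bar>K\<bar> * \<bar>D\<bar>"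
          using H(2)[of "x g"] F(2)[rule_format, of x] by (auto simp: norm_mult intro!: mult_mono)
      qed
      ultimately show ?thesis using UV unfolding equal_in_law_def by blast
    qed
    then have "(\<integral>g. (\<integral>\<omega>. (H (restrict (X \<omega>) SU2 g) * F (restrict (X \<omega>) SU2)) * U \<omega> \<partial>M) * cnj (\<kappa> g) \<partial>su2_measure) =
        (\<integral>g. (\<integral>\<omega>. (H (restrict (Y \<omega>) SU2 g) * F (restrict (Y \<omega>) SU2)) * V \<omega> \<partial>M) * cnj (\<kappa> g) \<partial>su2_measure)"
      by (intro Bochner_Integration.integral_cong) simp_all
    then show ?thesis using swap[OF X U] swap[OF Y V] by simp
  qed
  have meas: "(\<lambda>\<omega>. W \<omega> * su2_coeff \<kappa> (\<lambda>g. H (Z \<omega> g))) \<in> borel_measurable M"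
    if "random_field M Z" "W \<in> borel_measurable M" for Z W
    using that \<kappa>'(1) H(1) by (intro borel_measurable_times random_field_su2_coeff)
  show ?thesis
    unfolding equal_in_law_def
  proof (intro conjI exI ballI allI impI)
    fix \<omega> assume "\<omega> \<in> space M"
    then show "cmod (U \<omega> * su2_coeff \<kappa> (\<lambda>g. H (X \<omega> g))) \<le> \<bar>C\<bar> * (\<bar>K\<bar> * \<bar>B\<bar> * (16 * pi\<^sup>2))"
      and "cmod (V \<omega> * su2_coeff \<kappa> (\<lambda>g. H (Y \<omega> g))) \<le> \<bar>C\<bar> * (\<bar>K\<bar> * \<bar>B\<bar> * (16 * pi\<^sup>2))"
      using X Y U V by (auto intro: bound)
  qed (use X Y U V eq meas in blast)+
qed

section \<open>Inverting the energy by a geometric series\<close>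

lemma norm_mult_le_of_squares:
  assumes "(cmod a)\<^sup>2 \<le> x" "(cmod b)\<^sup>2 \<le> x"
  shows "cmod (a * cnj b) \<le> x"
proof -
  have "0 \<le> (cmod a - cmod b)\<^sup>2" by simp
  then have "2 * (cmod a * cmod b) \<le> (cmod a)\<^sup>2 + (cmod b)\<^sup>2" by (simp add: power2_diff)
  then show ?thesis using assms by (simp add: norm_mult)
qed

text \<open>The series \<open>1 / N = (1 / K) * (\<Sum>j. (1 - N / K) ^ j)\<close>, multiplied by
  \<open>a * cnj b\<close>. This factor is at most \<open>C * N\<close> in modulus, which bounds the
  partial sums by \<open>C\<close> even when \<open>N\<close> is arbitrarily small.\<close>

lemma geometric_inverse:
  fixes a b :: complex and N K C :: real
  assumes N: "0 \<le> N" "N \<le> K" "0 < K" and C: "0 \<le> C" "(cmod a)\<^sup>2 \<le> C * N" "(cmod b)\<^sup>2 \<le> C * N"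
  defines "s \<equiv> \<lambda>m. (\<Sum>j<m. a * cnj b * of_real (1 - N / K) ^ j) / of_real K"
  shows "cmod (s m) \<le> C" and "s \<longlonglongrightarrow> a * cnj b / of_real N"
proof -
  have "cmod (s m) \<le> C \<and> s \<longlonglongrightarrow> a * cnj b / of_real N"
  proof (cases "N = 0")
    \<comment> \<open>Here the hypotheses force \<open>a = 0\<close>; all partial sums vanish, in
      agreement with a quotient by zero being 0.\<close>
    case True
    then show ?thesis using C by (simp add: s_def)
  next
    case False
    let ?r = "1 - N / K"
    have r: "0 \<le> ?r" "?r < 1" using N False by (auto simp: field_simps)
    have s: "s m = a * cnj b * of_real (1 - ?r ^ m) / of_real N" for m
    proof -
      have "complex_of_real ?r \<noteq> 1" using r by (metis of_real_eq_1_iff order.irrefl)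
      then have "(\<Sum>j<m. complex_of_real ?r ^ j) = (of_real ?r ^ m - 1) / (of_real ?r - 1)"
        by (rule geometric_sum)
      also have "complex_of_real ?r - 1 = - (of_real N / of_real K)" by simp
      finally have "(\<Sum>j<m. complex_of_real ?r ^ j) / of_real K = of_real (1 - ?r ^ m) / of_real N"
        using N False by (simp add: field_simps)
      moreover have "s m = a * cnj b * ((\<Sum>j<m. complex_of_real ?r ^ j) / of_real K)"
        by (simp add: s_def sum_distrib_left)
      ultimately show ?thesis by simp
    qed
    have N0: "0 < N" using N(1) False by simp
    have "0 \<le> 1 - ?r ^ m" "1 - ?r ^ m \<le> 1" using r by (auto intro: power_le_one)
    then have "cmod (s m) \<le> cmod (a * cnj b) * 1 / N"
      using N0 unfolding s norm_divide norm_mult[of "a * cnj b"] norm_of_real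
      by (intro divide_right_mono mult_left_mono frac_le) auto
    also have "\<dots> \<le> C"
      using norm_mult_le_of_squares[OF C(2,3)] N False by (simp add: pos_divide_le_eq)
    finally have "cmod (s m) \<le> C" .
    moreover have "(\<lambda>m. a * cnj b * of_real (1 - ?r ^ m) / of_real N) \<longlonglongrightarrow> a * cnj b * of_real (1 - 0) / of_real N"
      using r False by (intro tendsto_intros LIMSEQ_realpow_zero) auto
    ultimately show ?thesis by (simp add: s[abs_def])
  qed
  then show "cmod (s m) \<le> C" and "s \<longlonglongrightarrow> a * cnj b / of_real N" by auto
qed

lemma su2_bounded_common:
  assumes "su2_bounded \<phi>" "su2_bounded \<psi>"
  obtains C where "0 \<le> C"
    "\<And>f. su2_square_integrable f \<Longrightarrow> (cmod (su2_coeff \<phi> f))\<^sup>2 \<le> C * su2_energy f"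
    "\<And>f. su2_square_integrable f \<Longrightarrow> (cmod (su2_coeff \<psi> f))\<^sup>2 \<le> C * su2_energy f"
proof -
  from assms obtain A B where \<phi>: "\<phi> \<in> borel_measurable su2_measure" "\<And>g. g \<in> SU2 \<Longrightarrow> cmod (\<phi> g) \<le> A"
    and \<psi>: "\<psi> \<in> borel_measurable su2_measure" "\<And>g. g \<in> SU2 \<Longrightarrow> cmod (\<psi> g) \<le> B"
    by (auto simp: su2_bounded_def)
  let ?m = "max A B"
  show ?thesis
  proof (rule that)
    show "0 \<le> ?m\<^sup>2 * (16 * pi\<^sup>2)" by simp
    show "(cmod (su2_coeff \<phi> f))\<^sup>2 \<le> ?m\<^sup>2 * (16 * pi\<^sup>2) * su2_energy f" if "su2_square_integrable f" for f
      using \<phi> by (intro su2_coeff_bound that) (auto simp: le_max_iff_disj)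
    show "(cmod (su2_coeff \<psi> f))\<^sup>2 \<le> ?m\<^sup>2 * (16 * pi\<^sup>2) * su2_energy f" if "su2_square_integrable f" for f
      using \<psi> by (intro su2_coeff_bound that) (auto simp: le_max_iff_disj)
  qed
qed

lemma su2_energy_trunc_le:
  assumes "f \<in> borel_measurable su2_measure"
  shows "su2_energy (\<lambda>g. trunc n (f g)) \<le> (real n)\<^sup>2 * (16 * pi\<^sup>2)"
proof -
  have "su2_energy (\<lambda>g. trunc n (f g)) \<le> (\<integral>g. (real n)\<^sup>2 \<partial>su2_measure)"
    unfolding su2_energy_def
    using su2_square_integrable_trunc[OF assms, of n]
    by (intro integral_mono) (auto simp: su2_square_integrable_def intro!: power_mono norm_trunc_le)
  then show ?thesis by (simp add: measure_su2 mult.commute)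
qed

text \<open>The factor \<open>1 - N / K\<close> of the geometric series for \<open>1 / N\<close> is itself an integral over the group.\<close>
lemma su2_coeff_one_minus_energy:
  assumes "f \<in> borel_measurable su2_measure" "0 < n"
  shows "su2_coeff (\<lambda>_. 1) (\<lambda>g. of_real ((1 - (cmod (trunc n (f g)))\<^sup>2 / (real n)\<^sup>2) / (16 * pi\<^sup>2))) =
    of_real (1 - su2_energy (\<lambda>g. trunc n (f g)) / ((real n)\<^sup>2 * (16 * pi\<^sup>2)))"
proof -
  have "integrable su2_measure (\<lambda>g. (cmod (trunc n (f g)))\<^sup>2)"
    using su2_square_integrable_trunc[OF assms(1)] by (simp add: su2_square_integrable_def)
  then have "(\<integral>g. 1 - (cmod (trunc n (f g)))\<^sup>2 / (real n)\<^sup>2 \<partial>su2_measure) =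
      16 * pi\<^sup>2 - su2_energy (\<lambda>g. trunc n (f g)) / (real n)\<^sup>2"
    by (simp add: su2_energy_def measure_su2)
  then have "(\<integral>g. (1 - (cmod (trunc n (f g)))\<^sup>2 / (real n)\<^sup>2) / (16 * pi\<^sup>2) \<partial>su2_measure) =
      1 - su2_energy (\<lambda>g. trunc n (f g)) / ((real n)\<^sup>2 * (16 * pi\<^sup>2))"
    by (simp only: integral_divide_zero) (simp add: diff_divide_distrib)
  then show ?thesis
    unfolding su2_coeff_def complex_cnj_one mult_1_right integral_complex_of_real by simp
qed

text \<open>A conjugated coefficient is again a coefficient, of the conjugated function, so it can
  enter a product through \<open>equal_in_law_mult_coeff\<close>.\<close>

lemma cnj_su2_coeff: "cnj (su2_coeff \<psi> f) = su2_coeff (\<lambda>g. cnj (\<psi> g)) (\<lambda>g. cnj (f g))"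
proof -
  have "cnj (su2_coeff \<psi> f) = (\<integral>g. cnj (f g * cnj (\<psi> g)) \<partial>su2_measure)"
    unfolding su2_coeff_def by (rule Bochner_Integration.integral_cnj[symmetric])
  then show ?thesis by (simp only: su2_coeff_def complex_cnj_mult)
qed

lemma su2_bounded_cnj: "su2_bounded \<psi> \<Longrightarrow> su2_bounded (\<lambda>g. cnj (\<psi> g))"
  by (auto simp: su2_bounded_def)

lemma law_determines_truncated_ratio:
  fixes M :: "'w measure"
  assumes M: "finite_measure M" and X: "random_field M X" and Y: "random_field M Y"
    and law: "field_law M X = field_law M Y"
    and \<phi>: "su2_bounded \<phi>" and \<psi>: "su2_bounded \<psi>" and n: "0 < n"
  defines "Q \<equiv> \<lambda>Z \<omega>. su2_coeff \<phi> (\<lambda>g. trunc n (Z \<omega> g)) * cnj (su2_coeff \<psi> (\<lambda>g. trunc n (Z \<omega> g))) /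
      of_real (su2_energy (\<lambda>g. trunc n (Z \<omega> g)))"
  shows "(\<integral>\<omega>. Q X \<omega> \<partial>M) = (\<integral>\<omega>. Q Y \<omega> \<partial>M)"
proof -
  interpret M: finite_measure M by fact
  let ?a = "\<lambda>Z \<omega>. su2_coeff \<phi> (\<lambda>g. trunc n (Z \<omega> g))"
  let ?b = "\<lambda>Z \<omega>. su2_coeff \<psi> (\<lambda>g. trunc n (Z \<omega> g))"
  let ?N = "\<lambda>Z \<omega>. su2_energy (\<lambda>g. trunc n (Z \<omega> g))"
  \<comment> \<open>The largest possible energy of a field truncated at \<open>n\<close>: the
    squared cut-off times the volume of the group. Hence \<open>?N Z \<omega> / ?K\<close> lies
    between 0 and 1.\<close>
  let ?K = "(real n)\<^sup>2 * (16 * pi\<^sup>2)"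
  let ?G = "\<lambda>z. complex_of_real ((1 - (cmod (trunc n z))\<^sup>2 / (real n)\<^sup>2) / (16 * pi\<^sup>2))"
  let ?R = "\<lambda>Z \<omega>. su2_coeff (\<lambda>_. 1) (\<lambda>g. ?G (Z \<omega> g))"
  have G: "?G \<in> borel_measurable borel" by measurable
  have Gb: "cmod (?G z) \<le> 1 / (16 * pi\<^sup>2)" for z
  proof -
    have "(cmod (trunc n z))\<^sup>2 / (real n)\<^sup>2 \<le> 1"
      using n norm_trunc_le(1)[of n z] by (simp add: power_mono)
    then have "\<bar>1 - (cmod (trunc n z))\<^sup>2 / (real n)\<^sup>2\<bar> \<le> 1" by simp
    then show ?thesis
      unfolding norm_of_real abs_divide by (intro divide_mono) auto
  qed
  have one: "su2_bounded (\<lambda>_. 1)" by (auto simp: su2_bounded_def)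
  have "equal_in_law M X Y (\<lambda>\<omega>. 1 * ?a X \<omega>) (\<lambda>\<omega>. 1 * ?a Y \<omega>)"
    by (rule equal_in_law_mult_coeff[OF M X Y equal_in_law_one[OF X Y law] \<phi> measurable_trunc norm_trunc_le(1)])
  moreover have "(\<lambda>z. cnj (trunc n z)) \<in> borel_measurable borel" by measurable
  ultimately have "equal_in_law M X Y (\<lambda>\<omega>. 1 * ?a X \<omega> * cnj (?b X \<omega>)) (\<lambda>\<omega>. 1 * ?a Y \<omega> * cnj (?b Y \<omega>))"
    unfolding cnj_su2_coeff
    by (rule equal_in_law_mult_coeff[OF M X Y _ su2_bounded_cnj[OF \<psi>], where K = "real n"])
      (simp add: norm_trunc_le)
  then have base: "equal_in_law M X Y (\<lambda>\<omega>. ?a X \<omega> * cnj (?b X \<omega>)) (\<lambda>\<omega>. ?a Y \<omega> * cnj (?b Y \<omega>))"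
    by simp
  \<comment> \<open>Each power of \<open>?R\<close>, the ratio of the geometric series, contributes
    one more group integral of a bounded function of the field.\<close>
  have pow: "equal_in_law M X Y (\<lambda>\<omega>. ?a X \<omega> * cnj (?b X \<omega>) * ?R X \<omega> ^ j) (\<lambda>\<omega>. ?a Y \<omega> * cnj (?b Y \<omega>) * ?R Y \<omega> ^ j)" for j
  proof (induction j)
    case 0
    show ?case using base by simp
  next
    case (Suc j)
    show ?case
      using equal_in_law_mult_coeff[OF M X Y Suc one G Gb] by (simp only: power_Suc2 mult.assoc)
  qed
  define s where "s Z m \<omega> = (\<Sum>j<m. ?a Z \<omega> * cnj (?b Z \<omega>) * ?R Z \<omega> ^ j) / of_real ?K"
    for Z :: "'w \<Rightarrow> cmat2 \<Rightarrow> complex" and m \<omega>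
  have eq: "(\<integral>\<omega>. s X m \<omega> \<partial>M) = (\<integral>\<omega>. s Y m \<omega> \<partial>M)" for m
  proof -
    have e: "(\<integral>\<omega>. ?a X \<omega> * cnj (?b X \<omega>) * ?R X \<omega> ^ j \<partial>M) = (\<integral>\<omega>. ?a Y \<omega> * cnj (?b Y \<omega>) * ?R Y \<omega> ^ j \<partial>M)"
      and "integrable M (\<lambda>\<omega>. ?a X \<omega> * cnj (?b X \<omega>) * ?R X \<omega> ^ j)"
      and "integrable M (\<lambda>\<omega>. ?a Y \<omega> * cnj (?b Y \<omega>) * ?R Y \<omega> ^ j)" for j
    proof -
      \<comment> \<open>Testing with the constant functional 1 turns the relation into equality of
        expectations.\<close>
      have "(\<lambda>_. 1 :: complex) \<in> borel_measurable (Pi\<^sub>M SU2 (\<lambda>_. borel))" "\<forall>x. cmod 1 \<le> 1" by simp_all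
      with pow[of j, unfolded equal_in_law_def]
      have "(\<integral>\<omega>. 1 * (?a X \<omega> * cnj (?b X \<omega>) * ?R X \<omega> ^ j) \<partial>M) = (\<integral>\<omega>. 1 * (?a Y \<omega> * cnj (?b Y \<omega>) * ?R Y \<omega> ^ j) \<partial>M)"
        by blast
      then show "(\<integral>\<omega>. ?a X \<omega> * cnj (?b X \<omega>) * ?R X \<omega> ^ j \<partial>M) = (\<integral>\<omega>. ?a Y \<omega> * cnj (?b Y \<omega>) * ?R Y \<omega> ^ j \<partial>M)"
        by simp
      obtain B where B: "\<forall>\<omega>\<in>space M. cmod (?a X \<omega> * cnj (?b X \<omega>) * ?R X \<omega> ^ j) \<le> B \<and>
          cmod (?a Y \<omega> * cnj (?b Y \<omega>) * ?R Y \<omega> ^ j) \<le> B"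
        using pow[of j] unfolding equal_in_law_def by blast
      show "integrable M (\<lambda>\<omega>. ?a X \<omega> * cnj (?b X \<omega>) * ?R X \<omega> ^ j)"
        by (rule M.integrable_const_bound[where B = B])
          (use B pow[of j] in \<open>auto simp: equal_in_law_def\<close>)
      show "integrable M (\<lambda>\<omega>. ?a Y \<omega> * cnj (?b Y \<omega>) * ?R Y \<omega> ^ j)"
        by (rule M.integrable_const_bound[where B = B])
          (use B pow[of j] in \<open>auto simp: equal_in_law_def\<close>)
    qed
    then show ?thesis
      unfolding s_def integral_divide_zero by (simp only: Bochner_Integration.integral_sum)
  qed
  obtain C where C: "0 \<le> C"
    "\<And>f. su2_square_integrable f \<Longrightarrow> (cmod (su2_coeff \<phi> f))\<^sup>2 \<le> C * su2_energy f"
    "\<And>f. su2_square_integrable f \<Longrightarrow> (cmod (su2_coeff \<psi> f))\<^sup>2 \<le> C * su2_energy f"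
    using su2_bounded_common[OF \<phi> \<psi>] by blast
  have lim: "(\<lambda>m. \<integral>\<omega>. s Z m \<omega> \<partial>M) \<longlonglongrightarrow> (\<integral>\<omega>. Q Z \<omega> \<partial>M)" if Z: "random_field M Z" for Z
  proof (rule integral_dominated_convergence)
    have [measurable]: "?a Z \<in> borel_measurable M" "?b Z \<in> borel_measurable M"
        "?R Z \<in> borel_measurable M" "?N Z \<in> borel_measurable M"
      using \<phi> \<psi> by (auto simp: su2_bounded_def
          intro!: random_field_su2_coeff[OF Z] random_field_su2_energy[OF Z] G)
    show "Q Z \<in> borel_measurable M" unfolding Q_def by measurable
    show "s Z m \<in> borel_measurable M" for m unfolding s_def by measurable
    show "integrable M (\<lambda>_. C)" by simp
    have "cmod (s Z m \<omega>) \<le> C \<and> (\<lambda>m. s Z m \<omega>) \<longlonglongrightarrow> Q Z \<omega>" if \<omega>: "\<omega> \<in> space M" for \<omega> m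
    proof -
      have m: "Z \<omega> \<in> borel_measurable su2_measure" by (rule random_field_section[OF Z \<omega>])
      have R: "?R Z \<omega> = of_real (1 - ?N Z \<omega> / ?K)" by (rule su2_coeff_one_minus_energy[OF m n])
      have sq: "su2_square_integrable (\<lambda>g. trunc n (Z \<omega> g))" by (rule su2_square_integrable_trunc[OF m])
      have K: "0 < ?K" using n by simp
      show ?thesis
        unfolding s_def Q_def R
        using geometric_inverse[OF su2_energy_nonneg su2_energy_trunc_le[OF m] K C(1) C(2)[OF sq] C(3)[OF sq]]
        by blast
    qed
    then show "AE \<omega> in M. (\<lambda>m. s Z m \<omega>) \<longlonglongrightarrow> Q Z \<omega>" "AE \<omega> in M. norm (s Z m \<omega>) \<le> C" for m
      by auto
  qed
  have "(\<lambda>m. \<integral>\<omega>. s X m \<omega> \<partial>M) \<longlonglongrightarrow> (\<integral>\<omega>. Q Y \<omega> \<partial>M)"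
    unfolding eq by (rule lim[OF Y])
  with lim[OF X] show ?thesis by (rule LIMSEQ_unique)
qed

text \<open>Truncation is removed in two layers of dominated convergence: on the group for
  coefficients and energy of one path, then on the probability space, where the quotients are
  bounded by \<open>C\<close>.\<close>

lemma law_determines_ratio:
  assumes M: "finite_measure M" and X: "random_field M X" and Y: "random_field M Y"
    and law: "field_law M X = field_law M Y"
    and sqX: "square_integrable_field M X" and sqY: "square_integrable_field M Y"
    and \<phi>: "su2_bounded \<phi>" and \<psi>: "su2_bounded \<psi>"
  shows "(\<integral>\<omega>. su2_coeff \<phi> (X \<omega>) * cnj (su2_coeff \<psi> (X \<omega>)) / of_real (su2_energy (X \<omega>)) \<partial>M) =
    (\<integral>\<omega>. su2_coeff \<phi> (Y \<omega>) * cnj (su2_coeff \<psi> (Y \<omega>)) / of_real (su2_energy (Y \<omega>)) \<partial>M)"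
proof -
  interpret M: finite_measure M by fact
  obtain C where C: "0 \<le> C"
    "\<And>f. su2_square_integrable f \<Longrightarrow> (cmod (su2_coeff \<phi> f))\<^sup>2 \<le> C * su2_energy f"
    "\<And>f. su2_square_integrable f \<Longrightarrow> (cmod (su2_coeff \<psi> f))\<^sup>2 \<le> C * su2_energy f"
    using su2_bounded_common[OF \<phi> \<psi>] by blast
  define q where "q f = su2_coeff \<phi> f * cnj (su2_coeff \<psi> f) / of_real (su2_energy f)" for f
  have q_le: "cmod (q f) \<le> C" if "su2_square_integrable f" for f
  proof (cases "su2_energy f = 0")
    case True
    then show ?thesis using C(1) by (simp add: q_def)
  next
    case False
    then show ?thesis
      using norm_mult_le_of_squares[OF C(2,3)[OF that]] su2_energy_nonneg[of f]
      by (simp add: q_def norm_divide pos_divide_le_eq)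
  qed
  have q_lim: "(\<lambda>n. q (\<lambda>g. trunc n (f g))) \<longlonglongrightarrow> q f" if f: "su2_square_integrable f" for f
  proof (cases "su2_energy f = 0")
    case True
    \<comment> \<open>Continuity of the quotient fails at energy 0, but truncation cannot raise the
      energy, so every quotient here is 0.\<close>
    have "su2_energy (\<lambda>g. trunc n (f g)) = 0" for n
    proof -
      have "su2_energy (\<lambda>g. trunc n (f g)) \<le> su2_energy f"
        unfolding su2_energy_def using f su2_square_integrable_trunc[of f n]
        by (intro integral_mono) (auto simp: su2_square_integrable_def intro!: power_mono norm_trunc_le)
      then show ?thesis using True su2_energy_nonneg[of "\<lambda>g. trunc n (f g)"] by simp
    qed
    then show ?thesis using True by (simp add: q_def)
  next
    case False
    then show ?thesis
      unfolding q_def by (intro tendsto_intros su2_coeff_trunc_tendsto su2_energy_trunc_tendsto f \<phi> \<psi>) simp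
  qed
  have lim: "(\<lambda>n. \<integral>\<omega>. q (\<lambda>g. trunc n (Z \<omega> g)) \<partial>M) \<longlonglongrightarrow> (\<integral>\<omega>. q (Z \<omega>) \<partial>M)"
    if Z: "random_field M Z" and sq: "square_integrable_field M Z" for Z
  proof (rule integral_dominated_convergence)
    have m: "(\<lambda>\<omega>. q (\<lambda>g. H (Z \<omega> g))) \<in> borel_measurable M" if "H \<in> borel_measurable borel" for H
    proof -
      have [measurable]: "(\<lambda>\<omega>. su2_coeff \<phi> (\<lambda>g. H (Z \<omega> g))) \<in> borel_measurable M"
          "(\<lambda>\<omega>. su2_coeff \<psi> (\<lambda>g. H (Z \<omega> g))) \<in> borel_measurable M"
          "(\<lambda>\<omega>. su2_energy (\<lambda>g. H (Z \<omega> g))) \<in> borel_measurable M"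
        using \<phi> \<psi> that by (auto simp: su2_bounded_def
            intro!: random_field_su2_coeff[OF Z] random_field_su2_energy[OF Z])
      show ?thesis unfolding q_def by measurable
    qed
    show "(\<lambda>\<omega>. q (Z \<omega>)) \<in> borel_measurable M" using m[of "\<lambda>z. z"] by simp
    show "(\<lambda>\<omega>. q (\<lambda>g. trunc n (Z \<omega> g))) \<in> borel_measurable M" for n
      by (rule m[OF measurable_trunc])
    show "integrable M (\<lambda>_. C)" by simp
    show "AE \<omega> in M. (\<lambda>n. q (\<lambda>g. trunc n (Z \<omega> g))) \<longlonglongrightarrow> q (Z \<omega>)"
      using sq unfolding square_integrable_field_def by (rule eventually_mono) (rule q_lim)
    show "AE \<omega> in M. norm (q (\<lambda>g. trunc n (Z \<omega> g))) \<le> C" for n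
      by (intro AE_I2 q_le su2_square_integrable_trunc random_field_section[OF Z])
  qed
  \<comment> \<open>Only eventual equality is available, since the truncated statement requires a
    positive cut-off.\<close>
  have "\<forall>\<^sub>F n in sequentially. (\<integral>\<omega>. q (\<lambda>g. trunc n (X \<omega> g)) \<partial>M) = (\<integral>\<omega>. q (\<lambda>g. trunc n (Y \<omega> g)) \<partial>M)"
    using law_determines_truncated_ratio[OF M X Y law \<phi> \<psi>]
    by (intro eventually_sequentiallyI[of 1]) (simp add: q_def)
  from Lim_transform_eventually[OF lim[OF X sqX] this] lim[OF Y sqY]
  have "(\<integral>\<omega>. q (X \<omega>) \<partial>M) = (\<integral>\<omega>. q (Y \<omega>) \<partial>M)" by (rule LIMSEQ_unique)
  then show ?thesis by (simp add: q_def)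
qed

subsection \<open>Second moments of a field\<close>

lemma integrable_mult_cnj:
  fixes u v :: "'a \<Rightarrow> complex"
  assumes m: "u \<in> borel_measurable N" "v \<in> borel_measurable N"
    and u: "integrable N (\<lambda>x. (cmod (u x))\<^sup>2)" "(\<integral>x. (cmod (u x))\<^sup>2 \<partial>N) \<le> c"
    and v: "integrable N (\<lambda>x. (cmod (v x))\<^sup>2)" "(\<integral>x. (cmod (v x))\<^sup>2 \<partial>N) \<le> d"
  shows "integrable N (\<lambda>x. u x * cnj (v x))" "(\<integral>x. cmod (u x * cnj (v x)) \<partial>N) \<le> c + d"
proof -
  have le: "cmod (u x * cnj (v x)) \<le> (cmod (u x))\<^sup>2 + (cmod (v x))\<^sup>2" for x
    by (rule norm_mult_le_of_squares) simp_all
  have i: "integrable N (\<lambda>x. (cmod (u x))\<^sup>2 + (cmod (v x))\<^sup>2)" using u v by simp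
  show "integrable N (\<lambda>x. u x * cnj (v x))"
    by (rule Bochner_Integration.integrable_bound[OF i]) (use le m in auto)
  then have "(\<integral>x. cmod (u x * cnj (v x)) \<partial>N) \<le> (\<integral>x. (cmod (u x))\<^sup>2 + (cmod (v x))\<^sup>2 \<partial>N)"
    using i le by (intro integral_mono) auto
  also have "\<dots> \<le> c + d" using u v by simp
  finally show "(\<integral>x. cmod (u x * cnj (v x)) \<partial>N) \<le> c + d" .
qed

text \<open>Tonelli: a bound on the first absolute moments that is uniform in \<open>g\<close>,
  integrated over a group of finite volume.\<close>

lemma integrable_pair_su2:
  fixes f :: "'w \<Rightarrow> cmat2 \<Rightarrow> 'b :: {banach, second_countable_topology}"
  assumes M: "finite_measure M" and f: "case_prod f \<in> borel_measurable (M \<Otimes>\<^sub>M su2_measure)"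
    and int: "\<And>g. g \<in> SU2 \<Longrightarrow> integrable M (\<lambda>\<omega>. f \<omega> g)"
    and le: "\<And>g. g \<in> SU2 \<Longrightarrow> (\<integral>\<omega>. norm (f \<omega> g) \<partial>M) \<le> D"
  shows "integrable (M \<Otimes>\<^sub>M su2_measure) (case_prod f)"
proof (rule integrableI_bounded[OF f])
  interpret M: finite_measure M by fact
  interpret P: pair_sigma_finite M su2_measure ..
  have "(\<integral>\<^sup>+p. ennreal (norm (case_prod f p)) \<partial>(M \<Otimes>\<^sub>M su2_measure)) =
      (\<integral>\<^sup>+g. (\<integral>\<^sup>+\<omega>. ennreal (norm (f \<omega> g)) \<partial>M) \<partial>su2_measure)"
    using P.nn_integral_snd[of "\<lambda>p. ennreal (norm (case_prod f p))"] f by simp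
  also have "\<dots> \<le> (\<integral>\<^sup>+g. ennreal D \<partial>su2_measure)"
    using int le by (intro nn_integral_mono) (simp add: nn_integral_eq_integral ennreal_leI)
  also have "\<dots> < \<infinity>" by (simp add: emeasure_su2_measure ennreal_mult_less_top)
  finally show "(\<integral>\<^sup>+p. ennreal (norm (case_prod f p)) \<partial>(M \<Otimes>\<^sub>M su2_measure)) < \<infinity>" .
qed

text \<open>Supplies the almost sure square integrability of paths that the weak notion of
  invariance does not state, together with a dominating variable for squared coefficients.\<close>

lemma second_moment_energy:
  assumes M: "finite_measure M" and X: "random_field M X"
    and int: "\<And>g. g \<in> SU2 \<Longrightarrow> integrable M (\<lambda>\<omega>. (cmod (X \<omega> g))\<^sup>2)"
    and le: "\<And>g. g \<in> SU2 \<Longrightarrow> (\<integral>\<omega>. (cmod (X \<omega> g))\<^sup>2 \<partial>M) \<le> c"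
  shows "square_integrable_field M X" "integrable M (\<lambda>\<omega>. su2_energy (X \<omega>))"
proof -
  interpret M: finite_measure M by fact
  interpret P: pair_sigma_finite M su2_measure ..
  have [measurable]: "case_prod X \<in> borel_measurable (M \<Otimes>\<^sub>M su2_measure)"
    using X by (simp add: random_field_def)
  have "(\<lambda>p. (cmod (case_prod X p))\<^sup>2) \<in> borel_measurable (M \<Otimes>\<^sub>M su2_measure)" by measurable
  then have "integrable (M \<Otimes>\<^sub>M su2_measure) (\<lambda>(\<omega>, g). (cmod (X \<omega> g))\<^sup>2)"
    using int le by (intro integrable_pair_su2[OF M, where D = c]) (simp_all add: split_beta')
  note i = this
  have "AE \<omega> in M. integrable su2_measure (\<lambda>g. (cmod (X \<omega> g))\<^sup>2)"
    using P.AE_integrable_fst'[OF i] by simp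
  moreover have "AE \<omega> in M. X \<omega> \<in> borel_measurable su2_measure"
    by (intro AE_I2 random_field_section[OF X])
  ultimately show "square_integrable_field M X"
    unfolding square_integrable_field_def su2_square_integrable_def by eventually_elim simp
  show "integrable M (\<lambda>\<omega>. su2_energy (X \<omega>))"
    using P.integrable_fst'[OF i] by (simp add: su2_energy_def)
qed

lemma second_moment_coeff:
  assumes M: "finite_measure M" and X: "random_field M X"
    and int: "\<And>g. g \<in> SU2 \<Longrightarrow> integrable M (\<lambda>\<omega>. (cmod (X \<omega> g))\<^sup>2)"
    and le: "\<And>g. g \<in> SU2 \<Longrightarrow> (\<integral>\<omega>. (cmod (X \<omega> g))\<^sup>2 \<partial>M) \<le> c"
    and \<phi>: "su2_bounded \<phi>"
  shows "(\<lambda>\<omega>. su2_coeff \<phi> (X \<omega>)) \<in> borel_measurable M"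
    and "integrable M (\<lambda>\<omega>. (cmod (su2_coeff \<phi> (X \<omega>)))\<^sup>2)"
proof -
  show m[measurable]: "(\<lambda>\<omega>. su2_coeff \<phi> (X \<omega>)) \<in> borel_measurable M"
    using \<phi> by (intro random_field_su2_coeff[OF X, of \<phi> "\<lambda>z. z"]) (simp_all add: su2_bounded_def)
  obtain C where C: "\<forall>f. su2_square_integrable f \<longrightarrow> (cmod (su2_coeff \<phi> f))\<^sup>2 \<le> C * su2_energy f"
    using su2_bounded_common[OF \<phi> \<phi>] by metis
  have second: "square_integrable_field M X" "integrable M (\<lambda>\<omega>. su2_energy (X \<omega>))"
    using int le by (auto intro: second_moment_energy[OF M X])
  show "integrable M (\<lambda>\<omega>. (cmod (su2_coeff \<phi> (X \<omega>)))\<^sup>2)"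
  proof (rule Bochner_Integration.integrable_bound)
    show "integrable M (\<lambda>\<omega>. C * su2_energy (X \<omega>))" using second(2) by simp
    show "(\<lambda>\<omega>. (cmod (su2_coeff \<phi> (X \<omega>)))\<^sup>2) \<in> borel_measurable M" by measurable
    show "AE \<omega> in M. norm ((cmod (su2_coeff \<phi> (X \<omega>)))\<^sup>2) \<le> norm (C * su2_energy (X \<omega>))"
      using second(1) unfolding square_integrable_field_def
    proof eventually_elim
      case (elim \<omega>)
      from C[rule_format, OF this] show ?case by simp
    qed
  qed
qed

text \<open>Fubini is used twice: with \<open>W\<close> the first coefficient, to pull out the
  integral against \<psi>, and with \<open>W\<close> the field at \<open>g'\<close>, to pull out the
  integral against \<phi>. Uniform second moments give the integrability.\<close>

lemma second_moment_formula:
  assumes M: "finite_measure M" and X: "random_field M X"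
    and int: "\<And>g. g \<in> SU2 \<Longrightarrow> integrable M (\<lambda>\<omega>. (cmod (X \<omega> g))\<^sup>2)"
    and le: "\<And>g. g \<in> SU2 \<Longrightarrow> (\<integral>\<omega>. (cmod (X \<omega> g))\<^sup>2 \<partial>M) \<le> c"
    and \<phi>: "su2_bounded \<phi>" and \<psi>: "su2_bounded \<psi>"
  shows "(\<integral>\<omega>. su2_coeff \<phi> (X \<omega>) * cnj (su2_coeff \<psi> (X \<omega>)) \<partial>M) =
    (\<integral>g'. (\<integral>g. (\<integral>\<omega>. X \<omega> g * cnj (X \<omega> g') \<partial>M) * cnj (\<phi> g) \<partial>su2_measure) * \<psi> g' \<partial>su2_measure)"
proof -
  interpret M: finite_measure M by fact
  interpret P: pair_sigma_finite M su2_measure ..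
  have X'[measurable]: "case_prod X \<in> borel_measurable (M \<Otimes>\<^sub>M su2_measure)"
    using X by (simp add: random_field_def)
  have Fubini: "(\<integral>\<omega>. W \<omega> * cnj (su2_coeff \<kappa> (X \<omega>)) \<partial>M) =
      (\<integral>g. (\<integral>\<omega>. W \<omega> * cnj (X \<omega> g) \<partial>M) * \<kappa> g \<partial>su2_measure)"
    if W: "W \<in> borel_measurable M" "integrable M (\<lambda>\<omega>. (cmod (W \<omega>))\<^sup>2)" and \<kappa>: "su2_bounded \<kappa>" for W \<kappa>
  proof -
    obtain B where B: "\<kappa> \<in> borel_measurable su2_measure" "\<And>g. g \<in> SU2 \<Longrightarrow> cmod (\<kappa> g) \<le> B"
      using \<kappa> by (auto simp: su2_bounded_def)
    note [measurable] = W(1) B(1)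
    let ?f = "\<lambda>\<omega> g. (W \<omega> * cnj (X \<omega> g)) * \<kappa> g"
    have "integrable (M \<Otimes>\<^sub>M su2_measure) (case_prod ?f)"
    proof (rule integrable_pair_su2[OF M])
      have "(\<lambda>p. (W (fst p) * cnj (case_prod X p)) * \<kappa> (snd p)) \<in> borel_measurable (M \<Otimes>\<^sub>M su2_measure)"
        by measurable
      then show "case_prod ?f \<in> borel_measurable (M \<Otimes>\<^sub>M su2_measure)" by (simp add: split_beta')
      fix g assume g: "g \<in> SU2"
      note i = integrable_mult_cnj[OF W(1) random_field_component[OF X g] W(2) order.refl int[OF g] le[OF g]]
      show "integrable M (\<lambda>\<omega>. ?f \<omega> g)" using i(1) by simp
      have "(\<integral>\<omega>. norm (?f \<omega> g) \<partial>M) = (\<integral>\<omega>. cmod (W \<omega> * cnj (X \<omega> g)) \<partial>M) * cmod (\<kappa> g)"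
        unfolding norm_mult[of "_ * _"] by (rule integral_mult_left_zero)
      also have "\<dots> \<le> ((\<integral>\<omega>. (cmod (W \<omega>))\<^sup>2 \<partial>M) + c) * B"
        using i(2) B(2)[OF g] order.trans[OF Bochner_Integration.integral_nonneg i(2)]
        by (intro mult_mono) auto
      finally show "(\<integral>\<omega>. norm (?f \<omega> g) \<partial>M) \<le> ((\<integral>\<omega>. (cmod (W \<omega>))\<^sup>2 \<partial>M) + c) * B" .
    qed
    from P.Fubini_integral[OF this]
    have "(\<integral>\<omega>. (\<integral>g. ?f \<omega> g \<partial>su2_measure) \<partial>M) = (\<integral>g. (\<integral>\<omega>. ?f \<omega> g \<partial>M) \<partial>su2_measure)" ..
    moreover have "(\<integral>g. ?f \<omega> g \<partial>su2_measure) = W \<omega> * cnj (su2_coeff \<kappa> (X \<omega>))" for \<omega>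
      unfolding cnj_su2_coeff by (simp add: su2_coeff_def mult.assoc)
    ultimately show ?thesis by simp
  qed
  have "(\<integral>\<omega>. su2_coeff \<phi> (X \<omega>) * cnj (X \<omega> g') \<partial>M) =
      (\<integral>g. (\<integral>\<omega>. X \<omega> g * cnj (X \<omega> g') \<partial>M) * cnj (\<phi> g) \<partial>su2_measure)" if g': "g' \<in> SU2" for g'
  proof -
    \<comment> \<open>\<open>Fubini\<close> handles a conjugated coefficient; here the coefficient
      is not conjugated, so the identity is proved for the conjugates and conjugated back.\<close>
    have "cnj (\<integral>\<omega>. su2_coeff \<phi> (X \<omega>) * cnj (X \<omega> g') \<partial>M) =
        (\<integral>\<omega>. cnj (su2_coeff \<phi> (X \<omega>) * cnj (X \<omega> g')) \<partial>M)"
      by (rule Bochner_Integration.integral_cnj[symmetric])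
    also have "\<dots> = (\<integral>\<omega>. X \<omega> g' * cnj (su2_coeff \<phi> (X \<omega>)) \<partial>M)"
      by (simp add: mult.commute)
    also have "\<dots> = (\<integral>g. (\<integral>\<omega>. X \<omega> g' * cnj (X \<omega> g) \<partial>M) * \<phi> g \<partial>su2_measure)"
      using int[OF g'] random_field_component[OF X g'] \<phi> by (intro Fubini)
    finally have "(\<integral>\<omega>. su2_coeff \<phi> (X \<omega>) * cnj (X \<omega> g') \<partial>M) =
        cnj (\<integral>g. (\<integral>\<omega>. X \<omega> g' * cnj (X \<omega> g) \<partial>M) * \<phi> g \<partial>su2_measure)"
      by (metis complex_cnj_cnj)
    also have "\<dots> = (\<integral>g. cnj ((\<integral>\<omega>. X \<omega> g' * cnj (X \<omega> g) \<partial>M) * \<phi> g) \<partial>su2_measure)"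
      by (rule Bochner_Integration.integral_cnj[symmetric])
    also have "\<dots> = (\<integral>g. (\<integral>\<omega>. X \<omega> g * cnj (X \<omega> g') \<partial>M) * cnj (\<phi> g) \<partial>su2_measure)"
    proof (rule Bochner_Integration.integral_cong[OF refl])
      fix g
      have "cnj (\<integral>\<omega>. X \<omega> g' * cnj (X \<omega> g) \<partial>M) = (\<integral>\<omega>. cnj (X \<omega> g' * cnj (X \<omega> g)) \<partial>M)"
        by (rule Bochner_Integration.integral_cnj[symmetric])
      then show "cnj ((\<integral>\<omega>. X \<omega> g' * cnj (X \<omega> g) \<partial>M) * \<phi> g) = (\<integral>\<omega>. X \<omega> g * cnj (X \<omega> g') \<partial>M) * cnj (\<phi> g)"
        by (simp add: mult.commute)
    qed
    finally show ?thesis .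
  qed
  then have inner: "(\<integral>g'. (\<integral>\<omega>. su2_coeff \<phi> (X \<omega>) * cnj (X \<omega> g') \<partial>M) * \<psi> g' \<partial>su2_measure) =
      (\<integral>g'. (\<integral>g. (\<integral>\<omega>. X \<omega> g * cnj (X \<omega> g') \<partial>M) * cnj (\<phi> g) \<partial>su2_measure) * \<psi> g' \<partial>su2_measure)"
    by (intro Bochner_Integration.integral_cong) simp_all
  have "(\<lambda>\<omega>. su2_coeff \<phi> (X \<omega>)) \<in> borel_measurable M"
    and "integrable M (\<lambda>\<omega>. (cmod (su2_coeff \<phi> (X \<omega>)))\<^sup>2)"
    using int le by (auto intro: second_moment_coeff[OF M X _ _ \<phi>])
  from Fubini[OF this \<psi>] inner show ?thesis by (rule trans)
qed

lemma covariance_determines_second_moment: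
  assumes M: "finite_measure M" and X: "random_field M X" and Y: "random_field M Y"
    and int: "\<And>g. g \<in> SU2 \<Longrightarrow> integrable M (\<lambda>\<omega>. (cmod (X \<omega> g))\<^sup>2)"
    and le: "\<And>g. g \<in> SU2 \<Longrightarrow> (\<integral>\<omega>. (cmod (X \<omega> g))\<^sup>2 \<partial>M) \<le> c"
    and intY: "\<And>g. g \<in> SU2 \<Longrightarrow> integrable M (\<lambda>\<omega>. (cmod (Y \<omega> g))\<^sup>2)"
    and cov: "\<And>g g'. g \<in> SU2 \<Longrightarrow> g' \<in> SU2 \<Longrightarrow>
      (\<integral>\<omega>. X \<omega> g * cnj (X \<omega> g') \<partial>M) = (\<integral>\<omega>. Y \<omega> g * cnj (Y \<omega> g') \<partial>M)"
    and \<phi>: "su2_bounded \<phi>" and \<psi>: "su2_bounded \<psi>"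
  shows "(\<integral>\<omega>. su2_coeff \<phi> (X \<omega>) * cnj (su2_coeff \<psi> (X \<omega>)) \<partial>M) =
    (\<integral>\<omega>. su2_coeff \<phi> (Y \<omega>) * cnj (su2_coeff \<psi> (Y \<omega>)) \<partial>M)"
proof -
  \<comment> \<open>The covariance on the diagonal is the second moment, so the bound for
    \<open>X\<close> carries over to \<open>Y\<close>.\<close>
  have leY: "(\<integral>\<omega>. (cmod (Y \<omega> g))\<^sup>2 \<partial>M) \<le> c" if g: "g \<in> SU2" for g
  proof -
    have "complex_of_real (\<integral>\<omega>. (cmod (Z \<omega> g))\<^sup>2 \<partial>M) = (\<integral>\<omega>. Z \<omega> g * cnj (Z \<omega> g) \<partial>M)" for Z
      by (simp only: complex_norm_square[symmetric] integral_complex_of_real)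
    then have "complex_of_real (\<integral>\<omega>. (cmod (Y \<omega> g))\<^sup>2 \<partial>M) = of_real (\<integral>\<omega>. (cmod (X \<omega> g))\<^sup>2 \<partial>M)"
      using cov[OF g g] by simp
    then show ?thesis using le[OF g] unfolding of_real_eq_iff by simp
  qed
  have "(\<integral>\<omega>. su2_coeff \<phi> (X \<omega>) * cnj (su2_coeff \<psi> (X \<omega>)) \<partial>M) =
      (\<integral>g'. (\<integral>g. (\<integral>\<omega>. X \<omega> g * cnj (X \<omega> g') \<partial>M) * cnj (\<phi> g) \<partial>su2_measure) * \<psi> g' \<partial>su2_measure)"
    using int le by (rule second_moment_formula[OF M X _ _ \<phi> \<psi>])
  also have "\<dots> = (\<integral>g'. (\<integral>g. (\<integral>\<omega>. Y \<omega> g * cnj (Y \<omega> g') \<partial>M) * cnj (\<phi> g) \<partial>su2_measure) * \<psi> g' \<partial>su2_measure)"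
  proof (rule Bochner_Integration.integral_cong[OF refl])
    fix g' assume g': "g' \<in> space su2_measure"
    have "(\<integral>g. (\<integral>\<omega>. X \<omega> g * cnj (X \<omega> g') \<partial>M) * cnj (\<phi> g) \<partial>su2_measure) =
        (\<integral>g. (\<integral>\<omega>. Y \<omega> g * cnj (Y \<omega> g') \<partial>M) * cnj (\<phi> g) \<partial>su2_measure)"
      by (rule Bochner_Integration.integral_cong[OF refl]) (use cov g' in simp)
    then show "(\<integral>g. (\<integral>\<omega>. X \<omega> g * cnj (X \<omega> g') \<partial>M) * cnj (\<phi> g) \<partial>su2_measure) * \<psi> g' =
        (\<integral>g. (\<integral>\<omega>. Y \<omega> g * cnj (Y \<omega> g') \<partial>M) * cnj (\<phi> g) \<partial>su2_measure) * \<psi> g'"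
      by simp
  qed
  also have "\<dots> = (\<integral>\<omega>. su2_coeff \<phi> (Y \<omega>) * cnj (su2_coeff \<psi> (Y \<omega>)) \<partial>M)"
    using intY leY by (rule second_moment_formula[OF M Y _ _ \<phi> \<psi>, symmetric])
  finally show ?thesis .
qed

subsection \<open>Uniformity on levels\<close>

text \<open>Kept abstract so that it covers rows (\<open>Q\<close> a Wigner matrix) and columns
  (\<open>Q\<close> its transpose), and both spectral probabilities through the weight
  \<open>w\<close>. The relation is only almost sure, because coefficients transform correctly on
  integrable paths.\<close>

lemma translated_form:
  fixes b b' :: "'w \<Rightarrow> nat \<Rightarrow> complex"
  assumes tr: "AE \<omega> in M. \<forall>i\<le>n. b' \<omega> i = (\<Sum>p\<le>n. cnj (Q i p) * b \<omega> p)"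
    and int: "\<And>p q. p \<le> n \<Longrightarrow> q \<le> n \<Longrightarrow> integrable M (\<lambda>\<omega>. b \<omega> p * cnj (b \<omega> q) * w \<omega>)"
    and meas: "\<And>i. i \<le> n \<Longrightarrow> (\<lambda>\<omega>. b' \<omega> i) \<in> borel_measurable M" "w \<in> borel_measurable M"
    and i: "i \<le> n" "i' \<le> n"
  shows "(\<integral>\<omega>. b' \<omega> i * cnj (b' \<omega> i') * w \<omega> \<partial>M) =
    (\<Sum>p\<le>n. \<Sum>q\<le>n. cnj (Q i p) * Q i' q * (\<integral>\<omega>. b \<omega> p * cnj (b \<omega> q) * w \<omega> \<partial>M))"
proof -
  let ?F = "\<lambda>\<omega>. \<Sum>p\<le>n. \<Sum>q\<le>n. cnj (Q i p) * Q i' q * (b \<omega> p * cnj (b \<omega> q) * w \<omega>)"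
  have "(\<integral>\<omega>. b' \<omega> i * cnj (b' \<omega> i') * w \<omega> \<partial>M) = (\<integral>\<omega>. ?F \<omega> \<partial>M)"
  proof (rule integral_cong_AE)
    show "(\<lambda>\<omega>. b' \<omega> i * cnj (b' \<omega> i') * w \<omega>) \<in> borel_measurable M"
      using meas(1)[OF i(1)] meas(1)[OF i(2)] meas(2) by measurable
    show "?F \<in> borel_measurable M"
      using int by (intro borel_measurable_sum borel_measurable_times borel_measurable_const
          borel_measurable_integrable) auto
    show "AE \<omega> in M. b' \<omega> i * cnj (b' \<omega> i') * w \<omega> = ?F \<omega>"
      using tr
    proof eventually_elim
      case (elim \<omega>)
      then have "b' \<omega> i = (\<Sum>p\<le>n. cnj (Q i p) * b \<omega> p)" "cnj (b' \<omega> i') = (\<Sum>q\<le>n. Q i' q * cnj (b \<omega> q))"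
        using i by simp_all
      then have "b' \<omega> i * cnj (b' \<omega> i') * w \<omega> =
          (\<Sum>p\<le>n. cnj (Q i p) * b \<omega> p) * (\<Sum>q\<le>n. Q i' q * cnj (b \<omega> q)) * w \<omega>"
        by simp
      also have "\<dots> = ?F \<omega>"
        unfolding sum_product unfolding sum_distrib_right by (intro sum.cong refl) (simp only: mult_ac)
      finally show ?case .
    qed
  qed
  also have "\<dots> = (\<Sum>p\<le>n. \<Sum>q\<le>n. cnj (Q i p) * Q i' q * (\<integral>\<omega>. b \<omega> p * cnj (b \<omega> q) * w \<omega> \<partial>M))"
  proof -
    have i: "integrable M (\<lambda>\<omega>. cnj (Q i p) * Q i' q * (b \<omega> p * cnj (b \<omega> q) * w \<omega>))"
      if "p \<in> {..n}" "q \<in> {..n}" for p q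
      using int that by (intro integrable_mult_right) auto
    have "(\<integral>\<omega>. ?F \<omega> \<partial>M) =
        (\<Sum>p\<le>n. \<integral>\<omega>. (\<Sum>q\<le>n. cnj (Q i p) * Q i' q * (b \<omega> p * cnj (b \<omega> q) * w \<omega>)) \<partial>M)"
      by (rule Bochner_Integration.integral_sum) (rule Bochner_Integration.integrable_sum, rule i)
    also have "\<dots> = (\<Sum>p\<le>n. \<Sum>q\<le>n. \<integral>\<omega>. cnj (Q i p) * Q i' q * (b \<omega> p * cnj (b \<omega> q) * w \<omega>) \<partial>M)"
      by (intro sum.cong refl Bochner_Integration.integral_sum i)
    finally show ?thesis by simp
  qed
  finally show ?thesis .
qed

lemma random_field_translate:
  assumes X: "random_field M X" and h: "h \<in> SU2" "h' \<in> SU2"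
  shows "random_field M (\<lambda>\<omega> g. X \<omega> (h ** g ** h'))"
proof -
  have "(\<lambda>p. (fst p, h ** snd p ** h')) \<in> M \<Otimes>\<^sub>M su2_measure \<rightarrow>\<^sub>M M \<Otimes>\<^sub>M su2_measure"
    by (intro measurable_Pair measurable_fst measurable_compose[OF measurable_snd measurable_su2_translation] h)
  from measurable_compose[OF this, of "case_prod X"] X
  show ?thesis by (simp add: random_field_def split_beta')
qed

text \<open>Common core of both cases: \<open>w\<close> is 1 for the weak and the inverse energy for
  the strong spectral probability. Left translations carry the first index to \<open>n\<close>,
  right translations then carry the second.\<close>

lemma coefficient_form_const:
  fixes M :: "'w measure" and w :: "'w \<Rightarrow> complex"
  assumes X: "random_field M X" and intX: "AE \<omega> in M. integrable su2_measure (X \<omega>)"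
    and w: "w \<in> borel_measurable M"
    and int: "\<And>\<phi> \<psi>. su2_bounded \<phi> \<Longrightarrow> su2_bounded \<psi> \<Longrightarrow>
      integrable M (\<lambda>\<omega>. su2_coeff \<phi> (X \<omega>) * cnj (su2_coeff \<psi> (X \<omega>)) * w \<omega>)"
    and inv: "\<And>h h' \<phi> \<psi>. h \<in> SU2 \<Longrightarrow> h' \<in> SU2 \<Longrightarrow> su2_bounded \<phi> \<Longrightarrow> su2_bounded \<psi> \<Longrightarrow>
      (\<integral>\<omega>. su2_coeff \<phi> (\<lambda>g. X \<omega> (h ** g ** h')) * cnj (su2_coeff \<psi> (\<lambda>g. X \<omega> (h ** g ** h'))) * w \<omega> \<partial>M) =
      (\<integral>\<omega>. su2_coeff \<phi> (X \<omega>) * cnj (su2_coeff \<psi> (X \<omega>)) * w \<omega> \<partial>M)"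
    and ij: "i \<le> n" "j \<le> n"
  shows "(\<integral>\<omega>. su2_coeff (phi_mat n i j) (X \<omega>) * cnj (su2_coeff (phi_mat n i j) (X \<omega>)) * w \<omega> \<partial>M) =
    (\<integral>\<omega>. su2_coeff (phi_mat n n n) (X \<omega>) * cnj (su2_coeff (phi_mat n n n) (X \<omega>)) * w \<omega> \<partial>M)"
proof -
  let ?C = "\<lambda>i j i' j'. (\<integral>\<omega>. su2_coeff (phi_mat n i j) (X \<omega>) * cnj (su2_coeff (phi_mat n i' j') (X \<omega>)) * w \<omega> \<partial>M)"
  have one: "mat 1 \<in> SU2" by (simp add: mat_1_eq_su2_mat su2_mat_in_SU2)
  have meas: "(\<lambda>\<omega>. su2_coeff \<phi> (\<lambda>g. X \<omega> (h ** g ** h'))) \<in> borel_measurable M"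
    if "h \<in> SU2" "h' \<in> SU2" "su2_bounded \<phi>" for h h' \<phi>
    using random_field_su2_coeff[OF random_field_translate[OF X that(1,2)], of \<phi> "\<lambda>z. z"] that(3)
    unfolding su2_bounded_def by simp
  have row: "?C i j i j = ?C n j n j" if i: "i \<le> n" and j: "j \<le> n" for i j
  proof (rule wigner_form_const_row[of n "\<lambda>i i'. ?C i j i' j", OF _ i])
    fix k i i' assume k: "k \<in> SU2" and i: "i \<le> n" "i' \<le> n"
    \<comment> \<open>Coefficients of the field translated by \<open>h\<close> mix through the
      Wigner matrix at the inverse of \<open>h\<close>, so \<open>h\<close> is taken inverse to the
      prescribed \<open>k\<close>.\<close>
    obtain h where h: "h \<in> SU2" "k ** h = mat 1" using SU2_inverse_exists[OF k] by blast
    let ?b = "\<lambda>\<omega> i. su2_coeff (phi_mat n i j) (X \<omega>)"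
    let ?b' = "\<lambda>\<omega> i. su2_coeff (phi_mat n i j) (\<lambda>g. X \<omega> (h ** g ** mat 1))"
    have "AE \<omega> in M. \<forall>i\<le>n. ?b' \<omega> i = (\<Sum>p\<le>n. cnj (wigner_mat n i p k) * ?b \<omega> p)"
      using intX by eventually_elim (simp add: su2_coeff_left[OF h(1) k h(2)] j)
    then have "(\<integral>\<omega>. ?b' \<omega> i * cnj (?b' \<omega> i') * w \<omega> \<partial>M) =
        (\<Sum>p\<le>n. \<Sum>q\<le>n. cnj (wigner_mat n i p k) * wigner_mat n i' q k * ?C p j q j)"
      using i j w by (intro translated_form int meas h(1) one su2_bounded_phi_mat) auto
    then show "?C i j i' j = (\<Sum>p\<le>n. \<Sum>q\<le>n. cnj (wigner_mat n i p k) * wigner_mat n i' q k * ?C p j q j)"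
      using inv[OF h(1) one su2_bounded_phi_mat[OF i(1) j] su2_bounded_phi_mat[OF i(2) j]] by simp
  qed
  have column: "?C i j i j = ?C i n i n" if i: "i \<le> n" and j: "j \<le> n" for i j
  proof (rule wigner_form_const_column[of n "\<lambda>j j'. ?C i j i j'", OF _ j])
    fix k j j' assume k: "k \<in> SU2" and j: "j \<le> n" "j' \<le> n"
    obtain h where h: "h \<in> SU2" "h ** k = mat 1" using SU2_inverse_exists[OF k] by blast
    let ?b = "\<lambda>\<omega> j. su2_coeff (phi_mat n i j) (X \<omega>)"
    let ?b' = "\<lambda>\<omega> j. su2_coeff (phi_mat n i j) (\<lambda>g. X \<omega> (mat 1 ** g ** h))"
    have "AE \<omega> in M. \<forall>j\<le>n. ?b' \<omega> j = (\<Sum>p\<le>n. cnj (wigner_mat n p j k) * ?b \<omega> p)"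
      using intX by eventually_elim (simp add: su2_coeff_right[OF h] i)
    then have "(\<integral>\<omega>. ?b' \<omega> j * cnj (?b' \<omega> j') * w \<omega> \<partial>M) =
        (\<Sum>p\<le>n. \<Sum>q\<le>n. cnj (wigner_mat n p j k) * wigner_mat n q j' k * ?C i p i q)"
      using i j w by (intro translated_form[where Q = "\<lambda>j p. wigner_mat n p j k"]
          int meas h(1) one su2_bounded_phi_mat) auto
    then show "?C i j i j' = (\<Sum>p\<le>n. \<Sum>q\<le>n. cnj (wigner_mat n p j k) * wigner_mat n q j' k * ?C i p i q)"
      using inv[OF one h(1) su2_bounded_phi_mat[OF i j(1)] su2_bounded_phi_mat[OF i j(2)]] by simp
  qed
  show ?thesis using row[OF ij] column[OF order.refl ij(2)] by simp
qed

text \<open>The entry of highest weight in both indices, \<open>real n - l\<close> being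
  \<open>l\<close> itself, serves as the common value on the level.\<close>

lemma uniform_on_levels_point_measure:
  assumes "\<And>n i j. i \<le> n \<Longrightarrow> j \<le> n \<Longrightarrow>
    f (real n / 2, real i - real n / 2, real j - real n / 2) = f (real n / 2, real n - real n / 2, real n - real n / 2)"
  shows "uniform_on_levels (point_measure spectral_index f)"
  unfolding uniform_on_levels_def
proof
  fix l assume l: "l \<in> half_nats"
  then obtain n where n: "l = real n / 2" by (auto simp: half_nats_def)
  have "emeasure (point_measure spectral_index f) {(l, m, s)} = f (l, real n - l, real n - l)"
    if m: "m \<in> weights l" and s: "s \<in> weights l" for m s
  proof -
    have "emeasure (point_measure spectral_index f) {(l, m, s)} = f (l, m, s)"
      using l m s by (subst emeasure_point_measure_finite2) (auto simp: spectral_index_def)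
    moreover obtain i j where "i \<le> n" "j \<le> n" "m = real i - l" "s = real j - l"
      using m s unfolding n weights_half by auto
    ultimately show ?thesis using assms[of i n j] by (simp add: n)
  qed
  then show "\<exists>c. \<forall>m\<in>weights l. \<forall>s\<in>weights l. emeasure (point_measure spectral_index f) {(l, m, s)} = c"
    by blast
qed

lemma wigner_coeff_eq_su2_coeff:
  "wigner_coeff f (real n / 2) (real i - real n / 2) (real j - real n / 2) = su2_coeff (phi_mat n i j) f"
  by (simp add: wigner_coeff_def su2_coeff_def phi_mat_def)

text \<open>\<open>matrix_inv\<close> is a choice among two-sided inverses; uniqueness of the
  inverse identifies it.\<close>

lemma matrix_inv_eqI:
  fixes A B :: cmat2
  assumes "A ** B = mat 1" "B ** A = mat 1"
  shows "matrix_inv A = B"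
proof -
  have "A ** matrix_inv A = mat 1 \<and> matrix_inv A ** A = mat 1"
    unfolding matrix_inv_def
    by (rule someI[of "\<lambda>C. A ** C = mat 1 \<and> C ** A = mat 1" B]) (simp add: assms)
  then show ?thesis by (metis assms(1) matrix_mul_assoc matrix_mul_lid matrix_mul_rid)
qed

lemma su2_translate_square_integrable:
  assumes f: "su2_square_integrable f" and h: "h \<in> SU2" "h' \<in> SU2"
  shows "su2_square_integrable (\<lambda>g. f (h ** g ** h'))"
    and "su2_energy (\<lambda>g. f (h ** g ** h')) = su2_energy f"
proof -
  let ?T = "\<lambda>g. h ** g ** h'"
  have m: "?T \<in> su2_measure \<rightarrow>\<^sub>M su2_measure" by (rule measurable_su2_translation[OF h])
  have "(\<lambda>g. h ** g) \<in> su2_measure \<rightarrow>\<^sub>M su2_measure" "(\<lambda>g. g ** h') \<in> su2_measure \<rightarrow>\<^sub>M su2_measure"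
    using measurable_su2_translation[OF h(1), of "mat 1"] measurable_su2_translation[OF _ h(2), of "mat 1"]
    by (simp_all add: su2_mat_in_SU2[of 1 0, folded mat_1_eq_su2_mat])
  then have "distr (distr su2_measure su2_measure (\<lambda>g. h ** g)) su2_measure (\<lambda>g. g ** h') =
      distr su2_measure su2_measure ?T"
    by (subst distr_distr) (auto simp: comp_def)
  then have d: "distr su2_measure su2_measure ?T = su2_measure"
    using h by (simp add: distr_su2_left distr_su2_right)
  have fm: "f \<in> borel_measurable su2_measure" and fi: "integrable su2_measure (\<lambda>g. (cmod (f g))\<^sup>2)"
    using f by (simp_all add: su2_square_integrable_def)
  have "integrable su2_measure (\<lambda>g. (cmod (f (?T g)))\<^sup>2)"
    using integrable_distr[OF m, of "\<lambda>g. (cmod (f g))\<^sup>2"] fi by (simp add: d)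
  then show "su2_square_integrable (\<lambda>g. f (?T g))"
    using measurable_compose[OF m fm] by (simp add: su2_square_integrable_def)
  show "su2_energy (\<lambda>g. f (?T g)) = su2_energy f"
    using integral_distr[OF m, of "\<lambda>g. (cmod (f g))\<^sup>2"] fi by (simp add: d su2_energy_def)
qed

section \<open>Uniformity of the weak and of the strong spectral probability\<close>

lemma two_weakly_bi_invariant_uniform:
  assumes M: "prob_space M" and X: "random_field M X" and weak: "two_weakly_bi_invariant M X"
  shows "uniform_on_levels (weak_spectral M X)"
proof -
  interpret prob_space M by fact
  have fin: "finite_measure M" by unfold_locales
  have one: "mat 1 \<in> SU2" by (simp add: mat_1_eq_su2_mat su2_mat_in_SU2)
  have int: "integrable M (\<lambda>\<omega>. (cmod (X \<omega> g))\<^sup>2)" if "g \<in> SU2" for g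
    using weak that by (simp add: two_weakly_bi_invariant_def)
  have cov: "(\<integral>\<omega>. X \<omega> (h ** g1 ** h') * cnj (X \<omega> (h ** g2 ** h')) \<partial>M) = (\<integral>\<omega>. X \<omega> g1 * cnj (X \<omega> g2) \<partial>M)"
    if "h \<in> SU2" "h' \<in> SU2" "g1 \<in> SU2" "g2 \<in> SU2" for h h' g1 g2
    using weak that by (simp add: two_weakly_bi_invariant_def)
  \<comment> \<open>Every \<open>g\<close> is a left translate of the identity, so invariance makes
    the second moment constant, and its value at \<open>mat 1\<close> is a uniform bound.\<close>
  let ?c = "\<integral>\<omega>. (cmod (X \<omega> (mat 1)))\<^sup>2 \<partial>M"
  have le: "(\<integral>\<omega>. (cmod (X \<omega> g))\<^sup>2 \<partial>M) \<le> ?c" if g: "g \<in> SU2" for g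
  proof -
    have "complex_of_real (\<integral>\<omega>. (cmod (X \<omega> g))\<^sup>2 \<partial>M) = (\<integral>\<omega>. X \<omega> g * cnj (X \<omega> g) \<partial>M)" for g
      by (simp only: complex_norm_square[symmetric] integral_complex_of_real)
    then have "complex_of_real (\<integral>\<omega>. (cmod (X \<omega> g))\<^sup>2 \<partial>M) = of_real ?c"
      using cov[OF g one one one] by simp
    then show ?thesis unfolding of_real_eq_iff by simp
  qed
  have "(\<integral>\<omega>. su2_coeff (phi_mat n i j) (X \<omega>) * cnj (su2_coeff (phi_mat n i j) (X \<omega>)) * 1 \<partial>M) =
      (\<integral>\<omega>. su2_coeff (phi_mat n n n) (X \<omega>) * cnj (su2_coeff (phi_mat n n n) (X \<omega>)) * 1 \<partial>M)"
    if "i \<le> n" "j \<le> n" for n i j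
  proof (rule coefficient_form_const[OF X _ _ _ _ that])
    have "square_integrable_field M X" using int le by (rule second_moment_energy(1)[OF fin X])
    then show "AE \<omega> in M. integrable su2_measure (X \<omega>)"
      unfolding square_integrable_field_def by (rule eventually_mono) (rule su2_square_integrable_integrable)
    show "integrable M (\<lambda>\<omega>. su2_coeff \<phi> (X \<omega>) * cnj (su2_coeff \<psi> (X \<omega>)) * 1)"
      if "su2_bounded \<phi>" "su2_bounded \<psi>" for \<phi> \<psi>
    proof -
      have "(\<lambda>\<omega>. su2_coeff \<kappa> (X \<omega>)) \<in> borel_measurable M"
        "integrable M (\<lambda>\<omega>. (cmod (su2_coeff \<kappa> (X \<omega>)))\<^sup>2)" if "su2_bounded \<kappa>" for \<kappa>
        using int le by (auto intro: second_moment_coeff[OF fin X _ _ that])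
      from integrable_mult_cnj(1)[OF this(1)[OF that(1)] this(1)[OF that(2)]
          this(2)[OF that(1)] order.refl this(2)[OF that(2)] order.refl]
      show ?thesis by simp
    qed
    show "(\<integral>\<omega>. su2_coeff \<phi> (\<lambda>g. X \<omega> (h ** g ** h')) * cnj (su2_coeff \<psi> (\<lambda>g. X \<omega> (h ** g ** h'))) * 1 \<partial>M) =
        (\<integral>\<omega>. su2_coeff \<phi> (X \<omega>) * cnj (su2_coeff \<psi> (X \<omega>)) * 1 \<partial>M)"
      if h: "h \<in> SU2" "h' \<in> SU2" and b: "su2_bounded \<phi>" "su2_bounded \<psi>" for h h' \<phi> \<psi>
    proof -
      have "(\<integral>\<omega>. su2_coeff \<phi> (X \<omega>) * cnj (su2_coeff \<psi> (X \<omega>)) \<partial>M) =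
          (\<integral>\<omega>. su2_coeff \<phi> (\<lambda>g. X \<omega> (h ** g ** h')) * cnj (su2_coeff \<psi> (\<lambda>g. X \<omega> (h ** g ** h'))) \<partial>M)"
      proof (rule covariance_determines_second_moment[OF fin X random_field_translate[OF X h] int le _ _ b])
        show "integrable M (\<lambda>\<omega>. (cmod (X \<omega> (h ** g ** h')))\<^sup>2)" if "g \<in> SU2" for g
          using h that by (intro int SU2_mult_closed)
        show "(\<integral>\<omega>. X \<omega> g * cnj (X \<omega> g') \<partial>M) = (\<integral>\<omega>. X \<omega> (h ** g ** h') * cnj (X \<omega> (h ** g' ** h')) \<partial>M)"
          if "g \<in> SU2" "g' \<in> SU2" for g g'
          using cov[OF h that] by simp
      qed
      then show ?thesis by simp
    qed
  qed simp
  note key = this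
  have eq: "(\<integral>\<omega>. (cmod (su2_coeff (phi_mat n i j) (X \<omega>)))\<^sup>2 \<partial>M) =
      (\<integral>\<omega>. (cmod (su2_coeff (phi_mat n n n) (X \<omega>)))\<^sup>2 \<partial>M)"
    if "i \<le> n" "j \<le> n" for n i j
    using key[OF that]
    by (simp only: complex_norm_square[symmetric] integral_complex_of_real mult_1_right of_real_eq_iff)
  show ?thesis
    unfolding weak_spectral_def
  proof (rule uniform_on_levels_point_measure, goal_cases)
    case (1 n i j)
    show ?case by (simp only: prod.case wigner_coeff_eq_su2_coeff eq[OF 1])
  qed
qed

lemma strongly_bi_invariant_uniform:
  assumes M: "prob_space M" and X: "random_field M X"
    and sq: "square_integrable_field M X" and strong: "strongly_bi_invariant M X"
  shows "uniform_on_levels (strong_spectral M X)"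
proof -
  interpret prob_space M by fact
  have fin: "finite_measure M" by unfold_locales
  \<comment> \<open>The weight is formed from \<open>X\<close> itself and takes the value 0 where
    the energy vanishes, by the convention for division.\<close>
  let ?w = "\<lambda>\<omega>. 1 / complex_of_real (su2_energy (X \<omega>))"
  have m: "(\<lambda>\<omega>. su2_coeff \<phi> (X \<omega>)) \<in> borel_measurable M" if "su2_bounded \<phi>" for \<phi>
    using random_field_su2_coeff[OF X _ measurable_ident_sets[OF refl], of \<phi>] that
    unfolding su2_bounded_def by simp
  have mw: "?w \<in> borel_measurable M"
    using random_field_su2_energy[OF X measurable_ident_sets[OF refl]] by simp
  have "(\<integral>\<omega>. su2_coeff (phi_mat n i j) (X \<omega>) * cnj (su2_coeff (phi_mat n i j) (X \<omega>)) * ?w \<omega> \<partial>M) =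
      (\<integral>\<omega>. su2_coeff (phi_mat n n n) (X \<omega>) * cnj (su2_coeff (phi_mat n n n) (X \<omega>)) * ?w \<omega> \<partial>M)"
    if "i \<le> n" "j \<le> n" for n i j
  proof (rule coefficient_form_const[OF X _ mw _ _ that])
    show "AE \<omega> in M. integrable su2_measure (X \<omega>)"
      using sq unfolding square_integrable_field_def
      by (rule eventually_mono) (rule su2_square_integrable_integrable)
    show "integrable M (\<lambda>\<omega>. su2_coeff \<phi> (X \<omega>) * cnj (su2_coeff \<psi> (X \<omega>)) * ?w \<omega>)"
      if b: "su2_bounded \<phi>" "su2_bounded \<psi>" for \<phi> \<psi>
    proof -
      obtain C where C: "0 \<le> C"
        "\<forall>f. su2_square_integrable f \<longrightarrow> (cmod (su2_coeff \<phi> f))\<^sup>2 \<le> C * su2_energy f"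
        "\<forall>f. su2_square_integrable f \<longrightarrow> (cmod (su2_coeff \<psi> f))\<^sup>2 \<le> C * su2_energy f"
        using su2_bounded_common[OF b] by metis
      show ?thesis
      proof (rule integrable_const_bound[where B = C])
        show "(\<lambda>\<omega>. su2_coeff \<phi> (X \<omega>) * cnj (su2_coeff \<psi> (X \<omega>)) * ?w \<omega>) \<in> borel_measurable M"
          by (intro borel_measurable_times borel_measurable_cnj m b mw)
        show "AE \<omega> in M. norm (su2_coeff \<phi> (X \<omega>) * cnj (su2_coeff \<psi> (X \<omega>)) * ?w \<omega>) \<le> C"
          using sq unfolding square_integrable_field_def
        proof eventually_elim
          case (elim \<omega>)
          have "cmod (su2_coeff \<phi> (X \<omega>) * cnj (su2_coeff \<psi> (X \<omega>))) \<le> C * su2_energy (X \<omega>)"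
            using C(2,3) elim by (intro norm_mult_le_of_squares) blast+
          then have "cmod (su2_coeff \<phi> (X \<omega>) * cnj (su2_coeff \<psi> (X \<omega>))) / su2_energy (X \<omega>) \<le> C"
            using C(1) su2_energy_nonneg[of "X \<omega>"] by (cases "su2_energy (X \<omega>) = 0") (simp_all add: pos_divide_le_eq)
          then show ?case
            using su2_energy_nonneg[of "X \<omega>"] by (simp add: norm_mult norm_divide)
        qed
      qed
    qed
    show "(\<integral>\<omega>. su2_coeff \<phi> (\<lambda>g. X \<omega> (h ** g ** h')) * cnj (su2_coeff \<psi> (\<lambda>g. X \<omega> (h ** g ** h'))) * ?w \<omega> \<partial>M) =
        (\<integral>\<omega>. su2_coeff \<phi> (X \<omega>) * cnj (su2_coeff \<psi> (X \<omega>)) * ?w \<omega> \<partial>M)"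
      if h: "h \<in> SU2" "h' \<in> SU2" and b: "su2_bounded \<phi>" "su2_bounded \<psi>" for h h' \<phi> \<psi>
    proof -
      let ?Y = "\<lambda>\<omega> g. X \<omega> (h ** g ** h')"
      have Y: "random_field M ?Y" by (rule random_field_translate[OF X h])
      have sqY: "square_integrable_field M ?Y"
        using sq unfolding square_integrable_field_def
        by (rule eventually_mono) (rule su2_translate_square_integrable(1)[OF _ h])
      \<comment> \<open>Strong invariance translates by \<open>matrix_inv\<close> of a group
        element, so it is invoked at the inverse \<open>k\<close> of \<open>h\<close>.\<close>
      obtain k where k: "k \<in> SU2" "h ** k = mat 1" "k ** h = mat 1"
        using SU2_inverse_exists[OF h(1)] by blast
      have "field_law M (\<lambda>\<omega> x. X \<omega> (matrix_inv k ** x ** h')) = field_law M X"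
        using strong k(1) h(2) by (simp add: strongly_bi_invariant_def)
      then have law: "field_law M ?Y = field_law M X"
        by (simp only: matrix_inv_eqI[OF k(3,2)])
      \<comment> \<open>\<open>law_determines_ratio\<close> needs numerator and denominator from the
        same field. Translation preserves the energy of almost every path, so the weight of
        \<open>X\<close> may be replaced by that of \<open>?Y\<close>.\<close>
      have "(\<integral>\<omega>. su2_coeff \<phi> (?Y \<omega>) * cnj (su2_coeff \<psi> (?Y \<omega>)) * ?w \<omega> \<partial>M) =
          (\<integral>\<omega>. su2_coeff \<phi> (?Y \<omega>) * cnj (su2_coeff \<psi> (?Y \<omega>)) / of_real (su2_energy (?Y \<omega>)) \<partial>M)"
      proof (rule integral_cong_AE)
        have mY: "(\<lambda>\<omega>. su2_coeff \<phi> (?Y \<omega>)) \<in> borel_measurable M" if "su2_bounded \<phi>" for \<phi>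
          using random_field_su2_coeff[OF Y _ measurable_ident_sets[OF refl], of \<phi>] that
          unfolding su2_bounded_def by simp
        note mY[OF b(1), measurable] mY[OF b(2), measurable] mw[measurable]
        have [measurable]: "(\<lambda>\<omega>. su2_energy (?Y \<omega>)) \<in> borel_measurable M"
          using random_field_su2_energy[OF Y measurable_ident_sets[OF refl]] by simp
        show "(\<lambda>\<omega>. su2_coeff \<phi> (?Y \<omega>) * cnj (su2_coeff \<psi> (?Y \<omega>)) * ?w \<omega>) \<in> borel_measurable M"
          by measurable
        show "(\<lambda>\<omega>. su2_coeff \<phi> (?Y \<omega>) * cnj (su2_coeff \<psi> (?Y \<omega>)) / of_real (su2_energy (?Y \<omega>))) \<in> borel_measurable M"
          by measurable
        show "AE \<omega> in M. su2_coeff \<phi> (?Y \<omega>) * cnj (su2_coeff \<psi> (?Y \<omega>)) * ?w \<omega> =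
            su2_coeff \<phi> (?Y \<omega>) * cnj (su2_coeff \<psi> (?Y \<omega>)) / of_real (su2_energy (?Y \<omega>))"
          using sq unfolding square_integrable_field_def
          by eventually_elim (simp add: su2_translate_square_integrable(2)[OF _ h])
      qed
      also have "\<dots> = (\<integral>\<omega>. su2_coeff \<phi> (X \<omega>) * cnj (su2_coeff \<psi> (X \<omega>)) / of_real (su2_energy (X \<omega>)) \<partial>M)"
        by (rule law_determines_ratio[OF fin Y X law sqY sq b])
      finally show ?thesis by simp
    qed
  qed
  note key = this
  have norm: "su2_coeff \<phi> (X \<omega>) * cnj (su2_coeff \<phi> (X \<omega>)) * ?w \<omega> =
      of_real ((cmod (su2_coeff \<phi> (X \<omega>)))\<^sup>2 / su2_energy (X \<omega>))" for \<phi> \<omega>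
    by (simp add: complex_norm_square del: of_real_power)
  have eq: "(\<integral>\<omega>. (cmod (su2_coeff (phi_mat n i j) (X \<omega>)))\<^sup>2 / su2_energy (X \<omega>) \<partial>M) =
      (\<integral>\<omega>. (cmod (su2_coeff (phi_mat n n n) (X \<omega>)))\<^sup>2 / su2_energy (X \<omega>) \<partial>M)"
    if "i \<le> n" "j \<le> n" for n i j
    using key[OF that] by (simp only: norm integral_complex_of_real of_real_eq_iff)
  show ?thesis
    unfolding strong_spectral_def
  proof (rule uniform_on_levels_point_measure, goal_cases)
    case (1 n i j)
    show ?case by (simp only: prod.case wigner_coeff_eq_su2_coeff su2_norm_square eq[OF 1])
  qed
qed

theorem theorem70:
  fixes M :: "'w measure" and X :: "'w \<Rightarrow> complex ^ 2 ^ 2 \<Rightarrow> complex"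
  assumes "prob_space M" and "random_field M X"
  shows "(two_weakly_bi_invariant M X \<and> (\<integral>\<omega>. (su2_norm (X \<omega>))\<^sup>2 \<partial>M) > 0 \<longrightarrow>
            uniform_on_levels (weak_spectral M X)) \<and>
         (square_integrable_field M X \<and> strongly_bi_invariant M X \<and>
            (AE \<omega> in M. su2_norm (X \<omega>) > 0) \<longrightarrow>
            uniform_on_levels (strong_spectral M X))"
  using two_weakly_bi_invariant_uniform[OF assms] strongly_bi_invariant_uniform[OF assms] by blast

end
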